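(* There are universal constants $c_0,c_0',c_1,c_2>0$ such that the following holds. Let $(\mathcal Q,d)$ be a bounded metric space, i.e. $\operatorname{diam}(\mathcal Q,d)<\infty$. Let $\beta>0$ and let $\ell=\lfloor\beta\rfloor$ be the largest integer strictly smaller than $\beta$. Consider the regression model and the local polynomial Fréchet estimator $\hat m_t$ of order $\ell$ with kernel $K$ and bandwidth $h$ described in the context, with $h\ge c_0/n$ and $n\ge c_0'$. Assume the conditions VarIneq (constant $C_{\mathrm{Vlo}}$), Entropy with $\alpha=1$ (constant $C_{\mathrm{Ent}}$), HölderSmoothDensity with smoothness $\beta$ (constant $C_{\mathrm{SmD}}$), and Kernel (constants $C_{\mathrm{Kmi}},C_{\mathrm{Kma}}$) of the context. Put $C_{\mathrm{Ker}}=C_{\mathrm{Kmi}}C_{\mathrm{Kma}}$. Then for all $t\in[0,1]$ $$\mathbb E\left[d(m_t,\hat m_t)^2\right]\le C_1h^{2\beta}+C_2(nh)^{-1},$$ where $$C_1=c_1\,C_{\mathrm{Vlo}}^2C_{\mathrm{Ker}}^2C_{\mathrm{SmD}}^2\operatorname{diam}(\mathcal Q,d)^2,\qquad C_2=c_2\,C_{\mathrm{Vlo}}^2C_{\mathrm{Ent}}^2C_{\mathrm{Ker}}^2\operatorname{diam}(\mathcal Q,d)^2.$$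
   Context: Model. $(\mathcal Q,d)$ is a metric space. For $t\in[0,1]$, $Y_t$ is a $\mathcal Q$-valued random variable with $\mathbb E[d(Y_t,q)^2]<\infty$ for all $q\in\mathcal Q$, and $m:[0,1]\to\mathcal Q$ satisfies $m_t\in\arg\min_{q\in\mathcal Q}\mathbb E[d(Y_t,q)^2]$. For $n\in\mathbb N$ let $x_i=i/n$, and let $y_1,\dots,y_n$ be independent with $y_i$ distributed as $Y_{x_i}$. Measurability of all random elements (including estimators) is silently assumed. Estimator. Let $K:\mathbb R\to\mathbb R$, $h>0$, $\Psi(x)=(x^k/k!)_{k=0,\dots,\ell}\in\mathbb R^{\ell+1}$, $$B_{n,t}=\frac1{nh}\sum_{i=1}^n\Psi\left(\tfrac{x_i-t}h\right)\Psi\left(\tfrac{x_i-t}h\right)^{\top}K\left(\tfrac{x_i-t}h\right),\qquad w_{i,t}=\frac1{nh}\Psi(0)^\top B_{n,t}^{-1}\Psi\left(\tfrac{x_i-t}h\right)K\left(\tfrac{x_i-t}h\right)$$ whenever $B_{n,t}$ is invertible. A local polynomial Fréchet estimator of order $\ell$ is any element $\hat m_t\in\arg\min_{q\in\mathcal Q}\sum_{i=1}^nw_{i,t}\,d(y_i,q)^2$. Entropy functional. For a (pseudo-)metric space $(\mathcal B,d)$, $\gamma_2(\mathcal B,d)=\inf\sup_{q\in\mathcal B}\sum_{k=0}^\infty2^{k/2}\operatorname{diam}(A_k(q),d)$, where the infimum is over all increasing sequences $(\mathcal A_k)_{k\ge0}$ of partitions of $\mathcal B$ (each set of $\mathcal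 A_{k+1}$ is contained in a set of $\mathcal A_k$) with $\mathcal A_0=\{\mathcal B\}$ and $\#\mathcal A_k\le2^{2^k}$ for $k\ge1$, and $A_k(q)$ is the element of $\mathcal A_k$ containing $q$. Here $\operatorname{diam}(\mathcal B,d)=\sup_{p,q\in\mathcal B}d(p,q)$. Hölder class. $\lfloor\beta\rfloor$ is the largest integer strictly smaller than $\beta$. $\Sigma(\beta,L)$ is the set of $\lfloor\beta\rfloor$-times continuously differentiable $f:[0,1]\to\mathbb R$ with $|f^{(\lfloor\beta\rfloor)}(t)-f^{(\lfloor\beta\rfloor)}(x)|\le L|x-t|^{\beta-\lfloor\beta\rfloor}$ for all $x,t\in[0,1]$. Conditions. - VarIneq: $C_{\mathrm{Vlo}}\in[1,\infty)$ and $C_{\mathrm{Vlo}}^{-1}d(q,m_t)^2\le\mathbb E[d(Y_t,q)^2-d(Y_t,m_t)^2]$ for all $q\in\mathcal Q$, $t\in[0,1]$. - Entropy with $\alpha=1$: $C_{\mathrm{Ent}}\in[1,\infty)$ and $\gamma_2(\mathcal B,d)\le C_{\mathrm{Ent}}\operatorname{diam}(\mathcal B,d)$ for all $\mathcal B\subseteq\mathcal Q$. - Kernel: $C_{\mathrm{Kmi}},C_{\mathrm{Kma}}\in[1,\infty)$ and $C_{\mathrm{Kmi}}^{-1}\mathbf 1_{[-1/2,1/2]}(x)\le K(x)\le C_{\mathrm{Kma}}\mathbf 1_{[-1,1]}(x)$ for all $x\in\mathbb R$. - HölderSmoothDensity: $t\mapsto m_t$ is continuous, with $C_{\mathrm{Len}}\in[1,\infty)$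 such that $\sup_{s,t\in[0,1]}d(m_s,m_t)\le C_{\mathrm{Len}}$; $\mu$ is a probability measure on $\mathcal Q$ and $C_{\mathrm{Int}}\in[1,\infty)$ with $\int d(y,m_0)^2\mu(\mathrm dy)\le C_{\mathrm{Int}}$; for each $t$, $Y_t$ has $\mu$-density $y\mapsto\rho(y|t)$; for $\mu$-almost all $y\in\mathcal Q$ there is $L(y)\ge0$ with $t\mapsto\rho(y|t)\in\Sigma(\beta,L(y))$; and $C_{\mathrm{SmD}}\in[1,\infty)$ with $\int L(y)^2\,\mathrm d\mu(y)\le C_{\mathrm{SmD}}^2$.
   Formalization: The constant c_2 may depend on the order ℓ=⌊β⌋ (c_0, c_0', c_1 remain universal), since no single c_2 works for all β; the constants are stated for metric spaces and sample spaces carried by fixed but arbitrary types, from which the general case follows by transport. *)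

theory Defs
  imports "HOL-Probability.Probability" "Jordan_Normal_Form.Gauss_Jordan_Elimination"
begin

section \<open>Metric entropy\<close>

text \<open>The diameter takes values in \<^typ>\<open>ennreal\<close>, so that unbounded sets have diameter
  \<^term>\<open>\<infinity>\<close>.\<close>

definition ediam :: "('a \<Rightarrow> 'a \<Rightarrow> real) \<Rightarrow> 'a set \<Rightarrow> ennreal" where
  "ediam d B = (SUP p\<in>B. SUP q\<in>B. ennreal (d p q))"

definition diam :: "('a \<Rightarrow> 'a \<Rightarrow> real) \<Rightarrow> 'a set \<Rightarrow> real" where
  "diam d B = enn2real (ediam d B)"

definition admissible :: "'a set \<Rightarrow> (nat \<Rightarrow> 'a set set) \<Rightarrow> bool" where
  "admissible B A \<longleftrightarrow>
     (\<forall>k. partition_on B (A k)) \<and>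
     (\<forall>k. refines B (A (Suc k)) (A k)) \<and>
     A 0 = {B} \<and>
     (\<forall>k\<ge>1. finite (A k) \<and> card (A k) \<le> 2 ^ (2 ^ k))"

definition part_of :: "'a set set \<Rightarrow> 'a \<Rightarrow> 'a set" where
  "part_of \<A> q = (THE S. S \<in> \<A> \<and> q \<in> S)"

definition gamma2 :: "('a \<Rightarrow> 'a \<Rightarrow> real) \<Rightarrow> 'a set \<Rightarrow> ennreal" where
  "gamma2 d B =
     (INF A\<in>{A. admissible B A}. SUP q\<in>B.
        (\<Sum>k. ennreal (2 powr (real k / 2)) * ediam d (part_of (A k) q)))"

text \<open>The empty set has no partition consisting of one nonempty part, so it is excluded here;
  otherwise the condition could never hold.\<close>

definition entropy_cond :: "'a set \<Rightarrow> ('a \<Rightarrow> 'a \<Rightarrow> real) \<Rightarrow> real \<Rightarrow> bool" where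
  "entropy_cond Q d CEnt \<longleftrightarrow> 1 \<le> CEnt \<and>
     (\<forall>B. B \<subseteq> Q \<and> B \<noteq> {} \<longrightarrow> gamma2 d B \<le> ennreal CEnt * ediam d B)"


section \<open>The regression model\<close>

definition metric_borel :: "'a set \<Rightarrow> ('a \<Rightarrow> 'a \<Rightarrow> real) \<Rightarrow> 'a measure" where
  "metric_borel Q d = sigma Q {U. openin (Metric_space.mtopology Q d) U}"

definition frechet_regression ::
    "'w measure \<Rightarrow> 'a set \<Rightarrow> ('a \<Rightarrow> 'a \<Rightarrow> real) \<Rightarrow> (real \<Rightarrow> 'w \<Rightarrow> 'a) \<Rightarrow> (real \<Rightarrow> 'a) \<Rightarrow> bool" where
  "frechet_regression P Q d Y m \<longleftrightarrow>
     (\<forall>t\<in>{0..1}. Y t \<in> measurable P (metric_borel Q d) \<and>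
        (\<forall>q\<in>Q. integrable P (\<lambda>\<omega>. (d (Y t \<omega>) q)\<^sup>2)) \<and>
        is_arg_min (\<lambda>q. \<integral>\<omega>. (d (Y t \<omega>) q)\<^sup>2 \<partial>P) (\<lambda>q. q \<in> Q) (m t))"

definition design_point :: "nat \<Rightarrow> nat \<Rightarrow> real" where
  "design_point n i = real i / real n"

definition regression_sample ::
    "'w measure \<Rightarrow> 'a set \<Rightarrow> ('a \<Rightarrow> 'a \<Rightarrow> real) \<Rightarrow> (real \<Rightarrow> 'w \<Rightarrow> 'a) \<Rightarrow> nat \<Rightarrow> (nat \<Rightarrow> 'w \<Rightarrow> 'a) \<Rightarrow> bool"
  where
  "regression_sample P Q d Y n y \<longleftrightarrow>
     prob_space.indep_vars P (\<lambda>_. metric_borel Q d) y {1..n} \<and>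
     (\<forall>i\<in>{1..n}. distr P (metric_borel Q d) (y i) =
                 distr P (metric_borel Q d) (Y (design_point n i)))"

definition var_ineq ::
    "'w measure \<Rightarrow> 'a set \<Rightarrow> ('a \<Rightarrow> 'a \<Rightarrow> real) \<Rightarrow> (real \<Rightarrow> 'w \<Rightarrow> 'a) \<Rightarrow> (real \<Rightarrow> 'a) \<Rightarrow> real \<Rightarrow> bool"
  where
  "var_ineq P Q d Y m CVlo \<longleftrightarrow> 1 \<le> CVlo \<and>
     (\<forall>q\<in>Q. \<forall>t\<in>{0..1}.
        inverse CVlo * (d q (m t))\<^sup>2 \<le> (\<integral>\<omega>. (d (Y t \<omega>) q)\<^sup>2 - (d (Y t \<omega>) (m t))\<^sup>2 \<partial>P))"


section \<open>Smooth densities\<close>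

definition strict_floor :: "real \<Rightarrow> nat" where
  "strict_floor \<beta> = (GREATEST k::nat. real k < \<beta>)"

text \<open>\<^term>\<open>D k\<close> is the \<^term>\<open>k\<close>-th derivative of \<^term>\<open>f\<close> on the unit interval, one-sided at
  the end points.\<close>

definition hoelder_class :: "real \<Rightarrow> real \<Rightarrow> (real \<Rightarrow> real) set" where
  "hoelder_class \<beta> L = {f. \<exists>D :: nat \<Rightarrow> real \<Rightarrow> real.
     (\<forall>x\<in>{0..1}. D 0 x = f x) \<and>
     (\<forall>k<strict_floor \<beta>. \<forall>x\<in>{0..1}. (D k has_real_derivative D (Suc k) x) (at x within {0..1})) \<and>
     continuous_on {0..1} (D (strict_floor \<beta>)) \<and>
     (\<forall>x\<in>{0..1}. \<forall>t\<in>{0..1}. \<bar>D (strict_floor \<beta>) t - D (strict_floor \<beta>) x\<bar>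
        \<le> L * \<bar>x - t\<bar> powr (\<beta> - real (strict_floor \<beta>)))}"

definition hoelder_smooth_density ::
    "'w measure \<Rightarrow> 'a set \<Rightarrow> ('a \<Rightarrow> 'a \<Rightarrow> real) \<Rightarrow> (real \<Rightarrow> 'w \<Rightarrow> 'a) \<Rightarrow> (real \<Rightarrow> 'a) \<Rightarrow>
     'a measure \<Rightarrow> ('a \<Rightarrow> real \<Rightarrow> real) \<Rightarrow> real \<Rightarrow> real \<Rightarrow> real \<Rightarrow> real \<Rightarrow> bool" where
  "hoelder_smooth_density P Q d Y m \<mu> \<rho> \<beta> CLen CInt CSmD \<longleftrightarrow>
     1 \<le> CLen \<and> 1 \<le> CInt \<and> 1 \<le> CSmD \<and>
     continuous_map (top_of_set {0..1}) (Metric_space.mtopology Q d) m \<and>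
     (\<forall>s\<in>{0..1}. \<forall>t\<in>{0..1}. d (m s) (m t) \<le> CLen) \<and>
     prob_space \<mu> \<and> sets \<mu> = sets (metric_borel Q d) \<and>
     (\<integral>\<^sup>+y. ennreal ((d y (m 0))\<^sup>2) \<partial>\<mu>) \<le> ennreal CInt \<and>
     (\<forall>y\<in>Q. \<forall>t\<in>{0..1}. 0 \<le> \<rho> y t) \<and>
     (\<forall>t\<in>{0..1}. distributed P \<mu> (Y t) (\<lambda>y. ennreal (\<rho> y t))) \<and>
     (\<exists>L. L \<in> borel_measurable \<mu> \<and>
        (AE y in \<mu>. 0 \<le> L y \<and> \<rho> y \<in> hoelder_class \<beta> (L y)) \<and>
        (\<integral>\<^sup>+y. ennreal ((L y)\<^sup>2) \<partial>\<mu>) \<le> ennreal (CSmD\<^sup>2))"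


section \<open>The local polynomial estimator\<close>

definition kernel_cond :: "(real \<Rightarrow> real) \<Rightarrow> real \<Rightarrow> real \<Rightarrow> bool" where
  "kernel_cond K CKmi CKma \<longleftrightarrow> 1 \<le> CKmi \<and> 1 \<le> CKma \<and>
     (\<forall>x. inverse CKmi * indicator {-1/2..1/2} x \<le> K x \<and> K x \<le> CKma * indicator {-1..1} x)"

definition lp_basis :: "nat \<Rightarrow> real \<Rightarrow> real Matrix.vec" where
  "lp_basis l x = Matrix.vec (l + 1) (\<lambda>k. x ^ k / fact k)"

definition lp_matrix :: "(real \<Rightarrow> real) \<Rightarrow> nat \<Rightarrow> nat \<Rightarrow> real \<Rightarrow> real \<Rightarrow> real Matrix.mat" where
  "lp_matrix K l n h t = Matrix.mat (l + 1) (l + 1) (\<lambda>(j, k).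
     1 / (real n * h) *
     (\<Sum>i=1..n. let u = (design_point n i - t) / h in
        vec_index (lp_basis l u) j * vec_index (lp_basis l u) k * K u))"

text \<open>Meaningful only if \<^term>\<open>lp_matrix K l n h t\<close> is invertible. For the kernel
  \<^term>\<open>indicator {-1..1}\<close> and \<^term>\<open>t = 0\<close>, the sum of the squared weights is asymptotically
  \<open>(l + 1)\<^sup>2 / (n h)\<close> as \<open>h \<rightarrow> 0\<close> and \<open>n h \<rightarrow> \<infinity>\<close>; a constant in front of \<open>1 / (n h)\<close> in a
  risk bound therefore has to depend on the order \<open>l\<close>.\<close>

definition lp_weight :: "(real \<Rightarrow> real) \<Rightarrow> nat \<Rightarrow> nat \<Rightarrow> real \<Rightarrow> real \<Rightarrow> nat \<Rightarrow> real" where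
  "lp_weight K l n h t i =
     (let u = (design_point n i - t) / h in
      1 / (real n * h) *
      scalar_prod (lp_basis l 0) (mult_mat_vec (the (mat_inverse (lp_matrix K l n h t))) (lp_basis l u)) *
      K u)"

definition lp_frechet_estimator ::
    "'w measure \<Rightarrow> 'a set \<Rightarrow> ('a \<Rightarrow> 'a \<Rightarrow> real) \<Rightarrow> (nat \<Rightarrow> 'w \<Rightarrow> 'a) \<Rightarrow> (real \<Rightarrow> real) \<Rightarrow>
     nat \<Rightarrow> nat \<Rightarrow> real \<Rightarrow> real \<Rightarrow> ('w \<Rightarrow> 'a) \<Rightarrow> bool" where
  "lp_frechet_estimator P Q d y K l n h t mhat \<longleftrightarrow>
     invertible_mat (lp_matrix K l n h t) \<and>
     mhat \<in> measurable P (metric_borel Q d) \<and>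
     (\<forall>\<omega>\<in>space P. is_arg_min (\<lambda>q. \<Sum>i=1..n. lp_weight K l n h t i * (d (y i \<omega>) q)\<^sup>2)
                     (\<lambda>q. q \<in> Q) (mhat \<omega>))"

end

theory Submission
  imports Defs
begin

text \<open>Write \<open>N = n h\<close> for the effective sample size, \<open>D\<close> for the diameter, \<open>w\<^sub>i\<close> for the weights and \<open>X q\<close> for the
centred criterion \<open>\<Sum>i. w\<^sub>i (d(y\<^sub>i,q)\<^sup>2 - E d(y\<^sub>i,q)\<^sup>2)\<close>. Since the estimator minimises the weighted criterion,
the variance inequality bounds \<open>d(mhat,m)\<^sup>2\<close> by \<open>CVlo\<close> times a bias, linear in \<open>d(mhat,m)\<close>, plus
\<open>CVlo \<bar>X mhat - X m\<bar>\<close>.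

\<^emph>\<open>Weights.\<close> Row 0 of the inverse of the matrix provides a polynomial \<open>p\<close> of degree at most \<open>l\<close> with
\<open>w\<^sub>i = p(u\<^sub>i) K(u\<^sub>i) / N\<close>, where \<open>u\<^sub>i = (x\<^sub>i - t)/h\<close>, and the weights reproduce polynomials of degree at most
\<open>l\<close>; in particular \<open>\<Sum>i. p(u\<^sub>i)\<^sup>2 K(u\<^sub>i) = N p(0)\<close>. As \<open>K \<ge> 1/CKmi\<close> on the inner window, everything about the
weights follows from an inequality \<open>N p(0)\<^sup>2 \<le> c(l) \<Sum> p(u\<^sub>i)\<^sup>2\<close> over the \<open>u\<^sub>i\<close> in the inner window: it gives
\<open>p(0) \<le> CKmi c(l)\<close>, then \<open>\<Sum> w\<^sub>i\<^sup>2 \<le> CKer c(l)/N\<close> and \<open>(\<Sum> \<bar>w\<^sub>i\<bar>)\<^sup>2 \<le> 3 CKer c(l)\<close> (lemma \<open>lp_weight_bounds\<close>).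
Lagrange interpolation at \<open>l + 1\<close> equispaced design points, averaged over the starting point, proves it as
soon as \<open>h \<le> 1\<close> and \<open>N \<ge> 2 (l + 1)\<close>, with \<open>c(l)\<close> growing only exponentially in \<open>l\<close>.

\<^emph>\<open>Bias.\<close> By reproduction only the Taylor remainder \<open>L(y) h\<^sup>\<beta> / (l - 1)!\<close> of the density contributes to the bias,
multiplied by \<open>\<Sum> \<bar>w\<^sub>i\<bar>\<close> (lemma \<open>lp_criterion_bias\<close>). The factorial beats \<open>c(l)\<close>, which is why the constant of the bias term is
independent of \<open>l\<close>, whereas the constant of the stochastic term inherits \<open>c(l)\<close>.

\<^emph>\<open>Stochastic term.\<close> By Hoeffding's inequality the increments of \<open>X\<close> are sub-Gaussian for the metric
\<open>2 D \<surd>(\<Sum> w\<^sub>i\<^sup>2) d\<close>. Generic chaining turns the entropy condition into sub-Gaussian tails of the supremum of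
\<open>\<bar>X q - X m\<bar>\<close> over every ball around \<open>m\<close> (lemma \<open>generic_chaining_tail\<close>), and a dyadic decomposition of
\<open>d(mhat,m)\<close> turns the tails at all scales into the second moment (lemma \<open>peeling_second_moment\<close>).

\<^emph>\<open>Degenerate regimes.\<close> The risk never exceeds \<open>D\<^sup>2\<close>. This already settles \<open>h > 1\<close>, where the bias term is at
least \<open>D\<^sup>2\<close>, and \<open>N < 2 (l + 1)\<close>, where the stochastic term is, so that no quantitative information on the
weights is required when the window contains too few points.\<close>

section \<open>Point evaluations of polynomials on an equispaced design\<close>

text \<open>The factors are the largest possible absolute values at 0 of the factors of the \<open>k\<close>-th Lagrange polynomial on
\<open>l + 1\<close> equispaced nodes of which the first lies within one step of 0. Their product is a binomial coefficient,
so interpolation to 0 costs a factor exponential in \<open>l\<close>.\<close>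

lemma prod_shifted_index_ratio:
  assumes "k \<le> l"
  shows "(\<Prod>j\<in>{..l} - {k}. (real j + 1) / \<bar>real k - real j\<bar>) = real (Suc l choose Suc k)"
  using assms
proof (induction l rule: dec_induct)
  case base
  have "(\<Prod>j<k. real k - real j) = fact k"
    by (simp add: fact_prod_rev atLeast0LessThan of_nat_diff)
  moreover have "(\<Prod>j<k. real j + 1) = fact k"
    by (induction k) (simp_all add: algebra_simps)
  moreover have "(\<Prod>j\<in>{..k} - {k}. (real j + 1) / \<bar>real k - real j\<bar>)
      = (\<Prod>j<k. (real j + 1) / (real k - real j))"
    by (intro prod.cong) auto
  ultimately show ?case
    by (simp add: prod_dividef)
next
  case (step l)
  have "{..Suc l} - {k} = insert (Suc l) ({..l} - {k})"
    using step.hyps by auto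
  then have "(\<Prod>j\<in>{..Suc l} - {k}. (real j + 1) / \<bar>real k - real j\<bar>)
      = (real l + 2) / (real l + 1 - real k) * real (Suc l choose Suc k)"
    using step by (simp add: add.commute)
  also have "\<dots> = real (Suc (Suc l) choose Suc k)"
  proof -
    have "(Suc (Suc l) - Suc k) * (Suc (Suc l) choose Suc k) = Suc (Suc l) * (Suc l choose Suc k)"
      using binomial_absorb_comp[of "Suc (Suc l)" "Suc k"] by simp
    then have "real ((Suc (Suc l) - Suc k) * (Suc (Suc l) choose Suc k))
        = real (Suc (Suc l) * (Suc l choose Suc k))"
      by (simp only:)
    then have "(real l + 1 - real k) * real (Suc (Suc l) choose Suc k)
        = (real l + 2) * real (Suc l choose Suc k)"
      using step.hyps by (simp only: of_nat_mult) (simp add: of_nat_diff algebra_simps)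
    then show ?thesis
      using step.hyps by (simp add: field_simps)
  qed
  finally show ?case .
qed

text \<open>Lagrange interpolation at the nodes \<open>s + k b\<close>, evaluated at 0.\<close>

lemma abs_poly_0_le_sum_equispaced:
  fixes p :: "real poly"
  assumes deg: "degree p \<le> l" and s: "0 \<le> s" "s \<le> b" and b: "0 < b"
  shows "\<bar>poly p 0\<bar> \<le> (\<Sum>k\<le>l. real (Suc l choose Suc k) * \<bar>poly p (s + real k * b)\<bar>)"
proof -
  define z where "z k = s + real k * b" for k
  have z_diff: "z k - z j = (real k - real j) * b" for k j
    by (simp add: z_def algebra_simps)
  have z_inj: "inj_on z {..l}"
    using b by (auto simp: inj_on_def z_def)
  define \<Lambda> where "\<Lambda> k = (\<Prod>j\<in>{..l} - {k}. Polynomial.smult (1 / (z k - z j)) [:- z j, 1:])" for k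
  have \<Lambda>_eval: "poly (\<Lambda> k) x = (\<Prod>j\<in>{..l} - {k}. (x - z j) / (z k - z j))" for k x
    by (simp add: \<Lambda>_def poly_prod diff_divide_distrib)
  have \<Lambda>_node: "poly (\<Lambda> k) (z i) = (if i = k then 1 else 0)" if "i \<le> l" "k \<le> l" for i k
  proof (cases "i = k")
    case True
    have "z k - z j \<noteq> 0" if "j \<noteq> k" for j
      using b that by (simp add: z_diff)
    then show ?thesis
      unfolding \<Lambda>_eval True by (auto intro!: prod.neutral)
  next
    case False
    then show ?thesis
      using that by (auto simp: \<Lambda>_eval)
  qed
  define q where "q = (\<Sum>k\<le>l. Polynomial.smult (poly p (z k)) (\<Lambda> k))"
  have "p = q"
  proof (rule poly_eqI_degree)
    fix x assume "x \<in> z ` {..l}"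
    then obtain i where i: "i \<le> l" "x = z i" by auto
    have "poly q x = (\<Sum>k\<le>l. if i = k then poly p (z k) else 0)"
      unfolding q_def i poly_sum poly_smult by (intro sum.cong refl) (simp add: \<Lambda>_node i)
    then show "poly p x = poly q x"
      using i by simp
  next
    have "degree (\<Lambda> k) \<le> l" if "k \<le> l" for k
    proof -
      have "degree (\<Lambda> k) \<le> (\<Sum>j\<in>{..l} - {k}. degree (Polynomial.smult (1 / (z k - z j)) [:- z j, 1:]))"
        unfolding \<Lambda>_def by (rule order_trans[OF degree_prod_sum_le]) (simp_all add: o_def)
      also have "\<dots> \<le> (\<Sum>j\<in>{..l} - {k}. 1)"
        by (intro sum_mono) (simp add: degree_smult_le)
      also have "\<dots> = l"
        using that by simp
      finally show ?thesis .
    qed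
    then have "degree q \<le> l"
      unfolding q_def by (intro degree_sum_le order_trans[OF degree_smult_le]) auto
    then show "degree q < card (z ` {..l})" "degree p < card (z ` {..l})"
      using deg z_inj by (simp_all add: card_image)
  qed
  have \<Lambda>_0: "\<bar>poly (\<Lambda> k) 0\<bar> \<le> real (Suc l choose Suc k)" if "k \<le> l" for k
  proof -
    have "\<bar>poly (\<Lambda> k) 0\<bar> = (\<Prod>j\<in>{..l} - {k}. \<bar>z j\<bar> / \<bar>z k - z j\<bar>)"
      by (simp add: \<Lambda>_eval abs_prod)
    also have "\<dots> \<le> (\<Prod>j\<in>{..l} - {k}. (real j + 1) / \<bar>real k - real j\<bar>)"
    proof (intro prod_mono conjI)
      fix j assume j: "j \<in> {..l} - {k}"
      have "\<bar>z j\<bar> \<le> (real j + 1) * b"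
        using s b by (simp add: z_def algebra_simps)
      moreover have "0 < \<bar>real k - real j\<bar>"
        using j by auto
      ultimately show "\<bar>z j\<bar> / \<bar>z k - z j\<bar> \<le> (real j + 1) / \<bar>real k - real j\<bar>"
        using b by (simp add: z_diff abs_mult divide_simps mult.commute mult.left_commute)
    qed auto
    also have "\<dots> = real (Suc l choose Suc k)"
      using that by (rule prod_shifted_index_ratio)
    finally show ?thesis .
  qed
  have "\<bar>poly p 0\<bar> = \<bar>poly q 0\<bar>"
    using \<open>p = q\<close> by simp
  also have "\<dots> = \<bar>\<Sum>k\<le>l. poly p (z k) * poly (\<Lambda> k) 0\<bar>"
    by (simp add: q_def poly_sum)
  also have "\<dots> \<le> (\<Sum>k\<le>l. \<bar>poly p (z k) * poly (\<Lambda> k) 0\<bar>)"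
    by (rule sum_abs)
  also have "\<dots> \<le> (\<Sum>k\<le>l. real (Suc l choose Suc k) * \<bar>poly p (z k)\<bar>)"
  proof (rule sum_mono)
    fix k assume "k \<in> {..l}"
    then have "\<bar>poly p (z k)\<bar> * \<bar>poly (\<Lambda> k) 0\<bar> \<le> \<bar>poly p (z k)\<bar> * real (Suc l choose Suc k)"
      by (intro mult_left_mono \<Lambda>_0) auto
    then show "\<bar>poly p (z k) * poly (\<Lambda> k) 0\<bar> \<le> real (Suc l choose Suc k) * \<bar>poly p (z k)\<bar>"
      by (simp add: abs_mult mult.commute)
  qed
  finally show ?thesis
    by (simp add: z_def)
qed

text \<open>Cauchy-Schwarz; the squares of the binomial coefficients sum up to at most the square of \<open>2 ^ (l + 1)\<close>.\<close>

lemma poly_0_squared_le_sum_equispaced: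
  fixes p :: "real poly"
  assumes "degree p \<le> l" "0 \<le> s" "s \<le> b" "0 < b"
  shows "(poly p 0)\<^sup>2 \<le> 4 ^ Suc l * (\<Sum>k\<le>l. (poly p (s + real k * b))\<^sup>2)"
proof -
  define a where "a k = real (Suc l choose Suc k)" for k
  define f where "f k = \<bar>poly p (s + real k * b)\<bar>" for k
  have "(\<Sum>k\<le>l. (a k)\<^sup>2) \<le> (\<Sum>k\<le>l. a k)\<^sup>2"
  proof -
    have "(\<Sum>k\<le>l. a k * a k) \<le> (\<Sum>k\<le>l. a k * (\<Sum>k\<le>l. a k))"
      by (intro sum_mono mult_left_mono member_le_sum) (auto simp: a_def)
    then show ?thesis
      by (simp add: power2_eq_square sum_distrib_right)
  qed
  also have "\<dots> \<le> (2 ^ Suc l)\<^sup>2"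
  proof (intro power_mono)
    have "(\<Sum>k\<le>l. a k) \<le> (\<Sum>k\<le>Suc l. real (Suc l choose k))"
      unfolding a_def sum.atMost_Suc_shift by simp
    also have "\<dots> = 2 ^ Suc l"
      using choose_row_sum[of "Suc l"] by (metis of_nat_sum of_nat_power of_nat_numeral)
    finally show "(\<Sum>k\<le>l. a k) \<le> 2 ^ Suc l" .
  qed (auto simp: a_def sum_nonneg)
  also have "(2 ^ Suc l)\<^sup>2 = (4 ^ Suc l :: real)"
    by (simp flip: power_mult_distrib add: power2_eq_square)
  finally have a: "(\<Sum>k\<le>l. (a k)\<^sup>2) \<le> 4 ^ Suc l" .
  have "(poly p 0)\<^sup>2 = \<bar>poly p 0\<bar>\<^sup>2"
    by simp
  also have "\<dots> \<le> (\<Sum>k\<le>l. a k * f k)\<^sup>2"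
    unfolding a_def f_def by (intro power_mono abs_poly_0_le_sum_equispaced assms) auto
  also have "\<dots> \<le> (\<Sum>k\<le>l. (a k)\<^sup>2) * (\<Sum>k\<le>l. (f k)\<^sup>2)"
    by (rule Cauchy_Schwarz_ineq_sum)
  also have "\<dots> \<le> 4 ^ Suc l * (\<Sum>k\<le>l. (f k)\<^sup>2)"
    by (intro mult_right_mono a sum_nonneg) auto
  finally show ?thesis
    by (simp add: f_def)
qed

text \<open>A grid of \<open>(l + 1) b\<close> consecutive points splits into \<open>b\<close> interleaved equispaced families of \<open>l + 1\<close> points
with step \<open>b / N\<close>. Adding the inequalities of all the families gains the factor \<open>b\<close>, which is what makes the
bound proportional to the number of points and not just a bound by a few of them.\<close>

lemma poly_0_squared_le_sum_grid:
  fixes p :: "real poly"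
  assumes deg: "degree p \<le> l" and \<theta>: "0 \<le> \<theta>" "\<theta> \<le> 1" and N: "0 < N"
  shows "real b * (poly p 0)\<^sup>2 \<le> 4 ^ Suc l * (\<Sum>i < Suc l * b. (poly p ((\<theta> + real i) / N))\<^sup>2)"
proof -
  define f where "f i = (poly p ((\<theta> + real i) / N))\<^sup>2" for i
  have block: "(\<Sum>a<b. f (k * b + a)) = sum f {k * b..<k * b + b}" for k
    using sum.shift_bounds_nat_ivl[of f 0 "k * b" b] by (simp add: atLeast0LessThan add.commute)
  have "(poly p 0)\<^sup>2 \<le> 4 ^ Suc l * (\<Sum>k\<le>l. f (k * b + a))" if a: "a < b" for a
  proof -
    have "(\<theta> + real a) / N \<le> real b / N"
      using a \<theta> N by (intro divide_right_mono) auto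
    then have "(poly p 0)\<^sup>2
        \<le> 4 ^ Suc l * (\<Sum>k\<le>l. (poly p ((\<theta> + real a) / N + real k * (real b / N)))\<^sup>2)"
      using a \<theta> N by (intro poly_0_squared_le_sum_equispaced deg) auto
    also have "(\<lambda>k. (\<theta> + real a) / N + real k * (real b / N)) = (\<lambda>k. (\<theta> + real (k * b + a)) / N)"
      by (simp add: fun_eq_iff add_divide_distrib)
    finally show ?thesis
      unfolding f_def .
  qed
  then have "(\<Sum>a<b. (poly p 0)\<^sup>2) \<le> (\<Sum>a<b. 4 ^ Suc l * (\<Sum>k\<le>l. f (k * b + a)))"
    by (intro sum_mono) auto
  also have "\<dots> = 4 ^ Suc l * (\<Sum>k<Suc l. \<Sum>a<b. f (k * b + a))"
    by (subst sum.swap) (simp only: sum_distrib_left lessThan_Suc_atMost)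
  also have "(\<Sum>k<Suc l. \<Sum>a<b. f (k * b + a)) = sum f {..<Suc l * b}"
    unfolding block by (rule sum.nat_group)
  finally show ?thesis
    by (simp add: f_def)
qed

text \<open>The constant \<open>c(l)\<close> of the point evaluation inequality on the design. Its exponential growth is what matters:
divided by \<open>((l - 1)!)\<^sup>2\<close> it stays bounded.\<close>

definition point_eval_const :: "nat \<Rightarrow> real" where
  "point_eval_const l = 4 * real (Suc l) * 4 ^ Suc l"

lemma point_eval_const_ge: "2 * real (Suc l) \<le> point_eval_const l"
proof -
  have "2 * real (Suc l) * 1 \<le> 4 * real (Suc l) * 4 ^ Suc l"
    by (intro mult_mono one_le_power) auto
  then show ?thesis
    by (simp add: point_eval_const_def)
qed

text \<open>The target \<open>t\<close> may be a boundary point, so the grid is laid out on the side of \<open>t\<close> that has at least half of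
the unit interval available; as \<open>h \<le> 1\<close>, a stretch of length \<open>h / 2\<close> fits there. The block length \<open>b\<close> is about
\<open>N / (2 (l + 1))\<close>, so that \<open>l + 1\<close> blocks fill the stretch.\<close>

lemma poly_0_squared_le_sum_design:
  fixes p :: "real poly"
  assumes deg: "degree p \<le> l" and t: "t \<in> {0..1}" and h: "0 < h" "h \<le> 1"
    and N: "2 * real (Suc l) \<le> real n * h"
  shows "real n * h * (poly p 0)\<^sup>2 \<le> point_eval_const l *
     (\<Sum>i | i \<in> {1..n} \<and> \<bar>(design_point n i - t) / h\<bar> \<le> 1/2. (poly p ((design_point n i - t) / h))\<^sup>2)"
proof -
  define N where "N = real n * h"
  define x where "x = N / (2 * real (Suc l))"
  define b where "b = nat \<lfloor>x\<rfloor>"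
  define u where "u i = (design_point n i - t) / h" for i
  define J where "J = {i. i \<in> {1..n} \<and> \<bar>u i\<bar> \<le> 1/2}"
  have N_ge: "2 * real (Suc l) \<le> N"
    using N by (simp add: N_def)
  have N0: "0 < N" and n0: "0 < n"
    using N_ge h by (auto simp: N_def intro: gr0I)
  have N_le: "N \<le> real n"
    using h mult_left_le[of h "real n"] by (simp add: N_def)
  have u_eq: "u i = (real i - real n * t) / N" for i
    using n0 h by (simp add: u_def design_point_def N_def field_simps)
  have x1: "1 \<le> x"
    unfolding x_def using N_ge by (subst le_divide_eq) auto
  have b_eq: "real b = of_int \<lfloor>x\<rfloor>"
    using x1 by (simp add: b_def)
  moreover have "1 \<le> real_of_int \<lfloor>x\<rfloor>"
    using x1 by simp
  ultimately have b_le: "real b \<le> x" and b_ge: "x / 2 \<le> real b"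
    by linarith+
  have mb: "real (Suc l) * real b \<le> N / 2"
  proof -
    have "real (Suc l) * real b \<le> real (Suc l) * x"
      by (intro mult_left_mono b_le) auto
    also have "\<dots> = N / 2"
      by (simp add: x_def divide_simps)
    finally show ?thesis .
  qed
  have i_le: "real i + 1 \<le> N / 2" if "i < Suc l * b" for i
  proof -
    have "real (Suc i) \<le> real (Suc l * b)"
      using that by (simp only: of_nat_le_iff Suc_le_eq)
    then show ?thesis
      using mb by (simp add: algebra_simps)
  qed
  have "real b * (poly p 0)\<^sup>2 \<le> 4 ^ Suc l * (\<Sum>i\<in>J. (poly p (u i))\<^sup>2)"
  proof (cases "t \<le> 1 / 2")
    case True
    \<comment> \<open>starting strictly to the right of \<open>t\<close> avoids the index 0, which is no design point\<close>
    define i0 where "i0 = Suc (nat \<lfloor>real n * t\<rfloor>)"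
    define \<theta> where "\<theta> = real i0 - real n * t"
    have \<theta>: "0 \<le> \<theta>" "\<theta> \<le> 1"
      using t unfolding \<theta>_def i0_def by (simp_all, (linarith+)?)
    have u_i0: "u (i0 + i) = (\<theta> + real i) / N" for i
      by (simp add: u_eq \<theta>_def)
    have "real b * (poly p 0)\<^sup>2 \<le> 4 ^ Suc l * (\<Sum>i < Suc l * b. (poly p (u (i0 + i)))\<^sup>2)"
      using poly_0_squared_le_sum_grid[OF deg \<theta> N0] by (simp only: u_i0)
    also have "(\<Sum>i < Suc l * b. (poly p (u (i0 + i)))\<^sup>2)
        = (\<Sum>i\<in>(+) i0 ` {..<Suc l * b}. (poly p (u i))\<^sup>2)"
      by (simp add: sum.reindex)
    also have "\<dots> \<le> (\<Sum>i\<in>J. (poly p (u i))\<^sup>2)"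
    proof (rule sum_mono2)
      show "(+) i0 ` {..<Suc l * b} \<subseteq> J"
      proof clarify
        fix i assume "i < Suc l * b"
        then have i: "real i + 1 \<le> N / 2"
          using i_le by auto
        have "real n * t \<le> real n * (1 / 2)"
          using True by (intro mult_left_mono) auto
        then have "real (i0 + i) \<le> real n"
          using \<theta> i N_le unfolding \<theta>_def of_nat_add by linarith
        moreover have "\<bar>u (i0 + i)\<bar> \<le> 1/2"
          using i \<theta> N0 unfolding u_i0 by (simp add: divide_simps)
        ultimately show "i0 + i \<in> J"
          unfolding J_def of_nat_le_iff by (auto simp: i0_def)
      qed
    qed (auto simp: J_def)
    finally show ?thesis
      by simp
  next
    case False
    define i0 where "i0 = nat \<lfloor>real n * t\<rfloor>"
    define \<theta> where "\<theta> = real n * t - real i0"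
    have \<theta>: "0 \<le> \<theta>" "\<theta> \<le> 1"
      using t unfolding \<theta>_def i0_def by (simp_all, (linarith+)?)
    have nt: "real n * (1 / 2) < real n * t" "real n * t \<le> real n * 1"
      using False n0 t by (intro mult_strict_left_mono mult_left_mono; auto)+
    have i_less: "i < i0" if "i < Suc l * b" for i
      using i_le[OF that] nt N_le \<theta> unfolding \<theta>_def by linarith
    have u_i0: "- u (i0 - i) = (\<theta> + real i) / N" if "i < Suc l * b" for i
      using i_less[OF that] by (simp add: u_eq \<theta>_def of_nat_diff diff_divide_distrib add_divide_distrib)
    have "degree (pcompose p [:0, -1:]) \<le> l"
      using deg by (simp add: degree_pcompose)
    from poly_0_squared_le_sum_grid[OF this \<theta> N0, of b]
    have "real b * (poly p 0)\<^sup>2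
        \<le> 4 ^ Suc l * (\<Sum>i < Suc l * b. (poly p (- ((\<theta> + real i) / N)))\<^sup>2)"
      by (simp add: poly_pcompose)
    also have "(\<Sum>i < Suc l * b. (poly p (- ((\<theta> + real i) / N)))\<^sup>2)
        = (\<Sum>i < Suc l * b. (poly p (u (i0 - i)))\<^sup>2)"
      by (intro sum.cong refl) (simp flip: u_i0)
    also have "\<dots> = (\<Sum>i\<in>(-) i0 ` {..<Suc l * b}. (poly p (u i))\<^sup>2)"
    proof (subst sum.reindex)
      show "inj_on ((-) i0) {..<Suc l * b}"
      proof (rule inj_onI)
        fix i j assume "i \<in> {..<Suc l * b}" "j \<in> {..<Suc l * b}" "i0 - i = i0 - j"
        then show "i = j"
          using i_less[of i] i_less[of j] by simp
      qed
    qed simp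
    also have "\<dots> \<le> (\<Sum>i\<in>J. (poly p (u i))\<^sup>2)"
    proof (rule sum_mono2)
      show "(-) i0 ` {..<Suc l * b} \<subseteq> J"
      proof clarify
        fix i assume i': "i < Suc l * b"
        then have i: "real i + 1 \<le> N / 2" "i < i0"
          using i_le i_less by auto
        have "i0 \<le> n"
          using nt \<theta> unfolding \<theta>_def by linarith
        moreover have "\<bar>u (i0 - i)\<bar> \<le> 1/2"
          unfolding abs_minus_cancel[of "u (i0 - i)", symmetric] u_i0[OF i']
          using i \<theta> N0 by (simp add: divide_simps)
        ultimately show "i0 - i \<in> J"
          unfolding J_def using i by auto
      qed
    qed (auto simp: J_def)
    finally show ?thesis
      by simp
  qed
  moreover have "N / (4 * real (Suc l)) \<le> real b"
    using b_ge by (simp add: x_def field_simps)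
  then have "N / (4 * real (Suc l)) * (poly p 0)\<^sup>2 \<le> real b * (poly p 0)\<^sup>2"
    by (intro mult_right_mono) auto
  ultimately have "N / (4 * real (Suc l)) * (poly p 0)\<^sup>2 \<le> 4 ^ Suc l * (\<Sum>i\<in>J. (poly p (u i))\<^sup>2)"
    by linarith
  then have "4 * real (Suc l) * (N / (4 * real (Suc l)) * (poly p 0)\<^sup>2)
      \<le> 4 * real (Suc l) * (4 ^ Suc l * (\<Sum>i\<in>J. (poly p (u i))\<^sup>2))"
    by (intro mult_left_mono) auto
  then have "N * (poly p 0)\<^sup>2 \<le> point_eval_const l * (\<Sum>i\<in>J. (poly p (u i))\<^sup>2)"
    by (simp add: point_eval_const_def mult.assoc del: of_nat_Suc)
  then show ?thesis
    by (simp add: N_def J_def u_def)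
qed

section \<open>The weights of the local polynomial estimator\<close>

lemma invertible_mat_inverse:
  fixes A :: "real Matrix.mat"
  assumes A: "A \<in> carrier_mat n n" and inv: "invertible_mat A"
  shows "the (mat_inverse A) * A = 1\<^sub>m n" "the (mat_inverse A) \<in> carrier_mat n n"
proof -
  from inv obtain B where AB: "A * B = 1\<^sub>m (dim_row A)" "B * A = 1\<^sub>m (dim_row B)"
    unfolding invertible_mat_def inverts_mat_def by auto
  have "dim_col B = n"
    using arg_cong[OF AB(1), of dim_col] A by simp
  moreover have "dim_row B = n"
    using arg_cong[OF AB(2), of dim_col] A by simp
  ultimately have B: "B \<in> carrier_mat n n"
    by auto
  then have "A \<in> Units (ring_mat TYPE(real) n n)"
    using A AB unfolding Units_def by (auto simp: ring_mat_simps)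
  then obtain C where "mat_inverse A = Some C"
    using mat_inverse(1)[OF A, where b = n] by (cases "mat_inverse A") auto
  then show "the (mat_inverse A) * A = 1\<^sub>m n" "the (mat_inverse A) \<in> carrier_mat n n"
    using mat_inverse(2)[OF A] by auto
qed

text \<open>The estimator only involves row 0 of the inverse, because \<open>\<Psi>(0)\<close> is the first unit vector. Reading off row 0
of inverse times matrix \<open>= 1\<close> gives the discrete moments of the weights, and thereby reproduction.\<close>

lemma lp_weight_polynomial:
  assumes inv: "invertible_mat (lp_matrix K l n h t)"
  obtains p :: "real poly" where "degree p \<le> l"
    and "\<And>i. lp_weight K l n h t i
          = poly p ((design_point n i - t) / h) * K ((design_point n i - t) / h) / (real n * h)"
    and "\<And>q. degree q \<le> l \<Longrightarrow>
          (\<Sum>i=1..n. lp_weight K l n h t i * poly q ((design_point n i - t) / h)) = poly q 0"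
proof -
  define B where "B = lp_matrix K l n h t"
  define V where "V = the (mat_inverse B)"
  define u where "u i = (design_point n i - t) / h" for i
  define w where "w i = lp_weight K l n h t i" for i
  define p where "p = (\<Sum>k\<le>l. monom (V $$ (0, k) / fact k) k)"
  have B: "B \<in> carrier_mat (Suc l) (Suc l)"
    by (simp add: B_def lp_matrix_def)
  have V: "V * B = 1\<^sub>m (Suc l)" "V \<in> carrier_mat (Suc l) (Suc l)"
    using invertible_mat_inverse[OF B] inv by (simp_all add: B_def V_def)
  have p_eval: "poly p x = (\<Sum>k<Suc l. V $$ (0, k) * (x ^ k / fact k))" for x
    by (simp add: p_def poly_sum poly_monom lessThan_Suc_atMost)
  have w_eq: "w i = poly p (u i) * K (u i) / (real n * h)" for i
  proof -
    have "scalar_prod (lp_basis l 0) (mult_mat_vec V (lp_basis l (u i)))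
        = (\<Sum>k<Suc l. 0 ^ k / fact k * (row V k \<bullet> lp_basis l (u i)))"
      using V(2) by (simp add: scalar_prod_def lp_basis_def atLeast0LessThan)
    also have "\<dots> = row V 0 \<bullet> lp_basis l (u i)"
      by (subst lessThan_Suc_eq_insert_0, subst sum.insert) (auto simp: image_iff intro!: sum.neutral)
    also have "\<dots> = poly p (u i)"
      using V(2) by (simp add: scalar_prod_def lp_basis_def p_eval atLeast0LessThan)
    finally show ?thesis
      by (simp add: w_def lp_weight_def Let_def u_def V_def B_def)
  qed
  have moment: "(\<Sum>i=1..n. w i * u i ^ j) = (if j = 0 then 1 else 0)" if j: "j \<le> l" for j
  proof -
    have "(1\<^sub>m (Suc l) :: real Matrix.mat) $$ (0, j) = (V * B) $$ (0, j)"
      by (simp add: V)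
    also have "\<dots> = (\<Sum>k<Suc l. V $$ (0, k) * B $$ (k, j))"
      using V(2) B j by (simp add: scalar_prod_def atLeast0LessThan)
    also have "\<dots> = (\<Sum>k<Suc l. \<Sum>i=1..n. V $$ (0, k) *
        (1 / (real n * h) * (u i ^ k / fact k * (u i ^ j / fact j) * K (u i))))"
      using j by (intro sum.cong refl) (simp add: B_def lp_matrix_def lp_basis_def Let_def u_def sum_distrib_left mult_ac)
    also have "\<dots> = (\<Sum>i=1..n. \<Sum>k<Suc l. V $$ (0, k) *
        (1 / (real n * h) * (u i ^ k / fact k * (u i ^ j / fact j) * K (u i))))"
      by (rule sum.swap)
    also have "\<dots> = (\<Sum>i=1..n. w i * u i ^ j / fact j)"
      unfolding w_eq p_eval sum_distrib_right sum_divide_distrib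
      by (intro sum.cong refl) (simp add: field_simps)
    also have "\<dots> = (\<Sum>i=1..n. w i * u i ^ j) / fact j"
      by (simp add: sum_divide_distrib)
    finally show ?thesis
      using j by (auto simp: field_simps split: if_splits)
  qed
  show thesis
  proof
    show "degree p \<le> l"
      unfolding p_def by (intro degree_sum_le) (auto intro: order_trans[OF degree_monom_le])
    show "lp_weight K l n h t i
          = poly p ((design_point n i - t) / h) * K ((design_point n i - t) / h) / (real n * h)" for i
      using w_eq[of i] by (simp add: w_def u_def)
    fix q :: "real poly" assume q: "degree q \<le> l"
    have q_eval: "poly q x = (\<Sum>j\<le>l. poly.coeff q j * x ^ j)" for x
      by (subst poly_as_sum_of_monoms'[OF q, symmetric]) (simp add: poly_sum poly_monom)
    have "(\<Sum>i=1..n. w i * poly q (u i)) = (\<Sum>i=1..n. \<Sum>j\<le>l. poly.coeff q j * (w i * u i ^ j))"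
      by (simp add: q_eval sum_distrib_left mult_ac)
    also have "\<dots> = (\<Sum>j\<le>l. poly.coeff q j * (\<Sum>i=1..n. w i * u i ^ j))"
      by (subst sum.swap) (simp only: sum_distrib_left)
    also have "\<dots> = (\<Sum>j\<le>l. poly.coeff q j * (if j = 0 then 1 else 0))"
      by (intro sum.cong refl) (simp only: moment atMost_iff)
    also have "\<dots> = (\<Sum>j\<le>l. if j = 0 then poly.coeff q j else 0)"
      by (intro sum.cong) auto
    also have "\<dots> = poly q 0"
      by (simp add: poly_0_coeff_0)
    finally show "(\<Sum>i=1..n. lp_weight K l n h t i * poly q ((design_point n i - t) / h)) = poly q 0"
      by (simp add: w_def u_def)
  qed
qed

lemma card_nat_near_le:
  fixes x N :: real
  assumes "1 \<le> N"
  shows "finite {i::nat. \<bar>real i - x\<bar> \<le> N}" "real (card {i::nat. \<bar>real i - x\<bar> \<le> N}) \<le> 3 * N"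
proof -
  let ?I = "{i::nat. \<bar>real i - x\<bar> \<le> N}"
  have sub: "int ` ?I \<subseteq> {\<lceil>x - N\<rceil>..\<lfloor>x + N\<rfloor>}"
    by (auto simp: ceiling_le_iff le_floor_iff)
  show "finite ?I"
    by (rule finite_imageD[OF finite_subset[OF sub]]) auto
  have "card ?I = card (int ` ?I)"
    by (simp add: card_image)
  also have "\<dots> \<le> card {\<lceil>x - N\<rceil>..\<lfloor>x + N\<rfloor>}"
    by (intro card_mono sub) auto
  also have "\<dots> = nat (\<lfloor>x + N\<rfloor> - \<lceil>x - N\<rceil> + 1)"
    by simp
  finally have "real (card ?I) \<le> real (nat (\<lfloor>x + N\<rfloor> - \<lceil>x - N\<rceil> + 1))"
    by (simp only: of_nat_le_iff)
  also have "\<dots> \<le> 3 * N"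
    using assms by linarith
  finally show "real (card ?I) \<le> 3 * N" .
qed

lemma kernel_condD:
  assumes "kernel_cond K CKmi CKma"
  shows "1 \<le> CKmi" "1 \<le> CKma" "0 \<le> K x" "K x \<le> CKma"
    "\<bar>x\<bar> \<le> 1/2 \<Longrightarrow> 1 / CKmi \<le> K x" "1 < \<bar>x\<bar> \<Longrightarrow> K x = 0"
proof -
  from assms have C: "1 \<le> CKmi" "1 \<le> CKma"
    and K: "inverse CKmi * indicator {-1/2..1/2} x \<le> K x" "K x \<le> CKma * indicator {-1..1} x"
    unfolding kernel_cond_def by auto
  show "1 \<le> CKmi" "1 \<le> CKma" by fact+
  have "0 \<le> inverse CKmi * indicator {-1/2..1/2} x"
    using C by (auto simp: indicator_def)
  then show pos: "0 \<le> K x"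
    using K by linarith
  have "CKma * indicator {-1..1} x \<le> CKma"
    using C by (auto simp: indicator_def)
  then show "K x \<le> CKma"
    using K by linarith
  show "1 / CKmi \<le> K x" if "\<bar>x\<bar> \<le> 1/2"
  proof -
    have "x \<in> {-1/2..1/2}" using that by (auto simp: abs_le_iff)
    then show ?thesis using K(1) by (simp add: inverse_eq_divide)
  qed
  show "K x = 0" if "1 < \<bar>x\<bar>"
  proof -
    have "x \<notin> {-1..1}" using that by auto
    then have "K x \<le> 0" using K(2) by simp
    then show ?thesis using pos by simp
  qed
qed

text \<open>Reproduction of \<open>p\<close> itself turns \<open>\<Sum> p(u\<^sub>i)\<^sup>2 K(u\<^sub>i)\<close> into \<open>N p(0)\<close>; compared with the point evaluation inequality
this is quadratic in \<open>p(0)\<close> on one side and linear on the other, which bounds \<open>p(0)\<close>. The sum of absolute values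
follows from Cauchy-Schwarz with \<open>\<bar>w\<^sub>i\<bar> = (\<bar>p\<bar> \<surd>K) (\<surd>K / N)\<close> and the count of design points in the window.\<close>

lemma lp_weight_bounds:
  assumes inv: "invertible_mat (lp_matrix K l n h t)" and K: "kernel_cond K CKmi CKma"
    and t: "t \<in> {0..1}" and h: "0 < h" "h \<le> 1" and N: "2 * real (Suc l) \<le> real n * h"
  shows "(\<Sum>i=1..n. (lp_weight K l n h t i)\<^sup>2) \<le> CKmi * CKma * point_eval_const l / (real n * h)"
    and "(\<Sum>i=1..n. \<bar>lp_weight K l n h t i\<bar>)\<^sup>2 \<le> 3 * (CKmi * CKma * point_eval_const l)"
proof -
  define u where "u i = (design_point n i - t) / h" for i
  define w where "w i = lp_weight K l n h t i" for i
  note Kd = kernel_condD[OF K]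
  have N1: "1 \<le> real n * h" and N0: "0 < real n * h"
    using N by simp_all
  from inv obtain p where p: "degree p \<le> l"
    and w_eq: "\<And>i. w i = poly p (u i) * K (u i) / (real n * h)"
    and repr: "\<And>q. degree q \<le> l \<Longrightarrow> (\<Sum>i=1..n. w i * poly q (u i)) = poly q 0"
    unfolding u_def w_def by (rule lp_weight_polynomial) blast
  define S where "S = (\<Sum>i=1..n. (poly p (u i))\<^sup>2 * K (u i))"
  have p0: "S = real n * h * poly p 0"
  proof -
    have "poly p 0 = (\<Sum>i=1..n. w i * poly p (u i))"
      using repr[OF p] by simp
    also have "\<dots> = S / (real n * h)"
      unfolding S_def sum_divide_distrib by (intro sum.cong) (auto simp: w_eq power2_eq_square)
    finally have "poly p 0 * (real n * h) = S"
      using N0 by (auto simp: eq_divide_eq split: if_splits)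
    then show ?thesis
      by (simp add: mult.commute)
  qed
  have S0: "0 \<le> S"
    unfolding S_def by (intro sum_nonneg mult_nonneg_nonneg Kd) auto
  then have p0_nonneg: "0 \<le> poly p 0"
    using p0 N0 by (simp add: zero_le_mult_iff)
  have "real n * h * (poly p 0)\<^sup>2 \<le> point_eval_const l * (\<Sum>i | i \<in> {1..n} \<and> \<bar>u i\<bar> \<le> 1/2. (poly p (u i))\<^sup>2)"
    using poly_0_squared_le_sum_design[OF p t h N] by (simp add: u_def)
  also have "\<dots> \<le> point_eval_const l * (CKmi * S)"
  proof (rule mult_left_mono)
    have "(\<Sum>i | i \<in> {1..n} \<and> \<bar>u i\<bar> \<le> 1/2. (poly p (u i))\<^sup>2)
        \<le> (\<Sum>i | i \<in> {1..n} \<and> \<bar>u i\<bar> \<le> 1/2. CKmi * ((poly p (u i))\<^sup>2 * K (u i)))"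
    proof (rule sum_mono)
      fix i assume "i \<in> {i. i \<in> {1..n} \<and> \<bar>u i\<bar> \<le> 1/2}"
      then have "1 / CKmi \<le> K (u i)"
        using Kd(5) by auto
      then have "(poly p (u i))\<^sup>2 * 1 \<le> (poly p (u i))\<^sup>2 * (CKmi * K (u i))"
        using Kd(1) by (intro mult_left_mono) (auto simp: field_simps)
      then show "(poly p (u i))\<^sup>2 \<le> CKmi * ((poly p (u i))\<^sup>2 * K (u i))"
        by (simp add: mult_ac)
    qed
    also have "\<dots> \<le> (\<Sum>i=1..n. CKmi * ((poly p (u i))\<^sup>2 * K (u i)))"
      using Kd(1,3) by (intro sum_mono2) auto
    finally show "(\<Sum>i | i \<in> {1..n} \<and> \<bar>u i\<bar> \<le> 1/2. (poly p (u i))\<^sup>2) \<le> CKmi * S"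
      by (simp add: S_def sum_distrib_left)
  qed (simp add: point_eval_const_def)
  finally have "(real n * h) * (poly p 0 * poly p 0) \<le> (real n * h) * (CKmi * point_eval_const l * poly p 0)"
    by (simp add: p0 power2_eq_square mult_ac)
  then have "poly p 0 * poly p 0 \<le> CKmi * point_eval_const l * poly p 0"
    using N0 by (rule mult_left_le_imp_le)
  then have p0_le: "poly p 0 \<le> CKmi * point_eval_const l"
    using p0_nonneg Kd(1)
    by (cases "poly p 0 = 0") (auto simp: point_eval_const_def)
  have S_le: "S \<le> real n * h * (CKmi * point_eval_const l)"
    unfolding p0 using N0 by (intro mult_left_mono p0_le) auto
  have "(\<Sum>i=1..n. (w i)\<^sup>2) \<le> (\<Sum>i=1..n. CKma / (real n * h)\<^sup>2 * ((poly p (u i))\<^sup>2 * K (u i)))"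
  proof (rule sum_mono)
    fix i
    have "(poly p (u i))\<^sup>2 * K (u i) * K (u i) \<le> (poly p (u i))\<^sup>2 * K (u i) * CKma"
      by (intro mult_left_mono mult_nonneg_nonneg Kd) auto
    then have "(poly p (u i))\<^sup>2 * K (u i) * K (u i) / (real n * h)\<^sup>2
        \<le> (poly p (u i))\<^sup>2 * K (u i) * CKma / (real n * h)\<^sup>2"
      by (intro divide_right_mono) auto
    then show "(w i)\<^sup>2 \<le> CKma / (real n * h)\<^sup>2 * ((poly p (u i))\<^sup>2 * K (u i))"
      by (simp add: w_eq power_mult_distrib power_divide power2_eq_square mult_ac)
  qed
  also have "\<dots> = CKma / (real n * h)\<^sup>2 * S"
    by (simp add: S_def sum_distrib_left)
  also have "\<dots> \<le> CKma / (real n * h)\<^sup>2 * (real n * h * (CKmi * point_eval_const l))"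
    using Kd(2) by (intro mult_left_mono S_le) auto
  also have "\<dots> = CKmi * CKma * point_eval_const l / (real n * h)"
    using N0 by (simp add: power2_eq_square)
  finally show "(\<Sum>i=1..n. (lp_weight K l n h t i)\<^sup>2) \<le> CKmi * CKma * point_eval_const l / (real n * h)"
    by (simp add: w_def)
  have K_sum: "(\<Sum>i=1..n. K (u i)) \<le> CKma * (3 * (real n * h))"
  proof -
    define J where "J = {i::nat. \<bar>real i - real n * t\<bar> \<le> real n * h}"
    have n0: "0 < n"
      using N0 by (cases n) auto
    have near: "\<bar>real i - real n * t\<bar> \<le> real n * h" if "\<bar>u i\<bar> \<le> 1" for i
    proof -
      have "real i - real n * t = real n * h * u i"
        using n0 h by (simp add: u_def design_point_def field_simps)
      then have "\<bar>real i - real n * t\<bar> = real n * h * \<bar>u i\<bar>"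
        using h by (simp add: abs_mult)
      also have "\<dots> \<le> real n * h * 1"
        using that h by (intro mult_left_mono) auto
      finally show ?thesis by simp
    qed
    have "(\<Sum>i=1..n. K (u i)) = (\<Sum>i\<in>{1..n} \<inter> J. K (u i))"
    proof (rule sum.mono_neutral_right)
      show "\<forall>i\<in>{1..n} - {1..n} \<inter> J. K (u i) = 0"
        using near Kd(6) unfolding J_def by force
    qed auto
    also have "\<dots> \<le> (\<Sum>i\<in>{1..n} \<inter> J. CKma)"
      by (intro sum_mono Kd)
    also have "\<dots> = CKma * real (card ({1..n} \<inter> J))"
      by simp
    also have "\<dots> \<le> CKma * (3 * (real n * h))"
    proof (rule mult_left_mono)
      have "card ({1..n} \<inter> J) \<le> card J"
        unfolding J_def by (intro card_mono card_nat_near_le N1) auto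
      then show "real (card ({1..n} \<inter> J)) \<le> 3 * (real n * h)"
        using card_nat_near_le(2)[OF N1, of "real n * t"] unfolding J_def by linarith
    qed (use Kd(2) in simp)
    finally show ?thesis .
  qed
  have "(\<Sum>i=1..n. \<bar>w i\<bar>)\<^sup>2
      = (\<Sum>i=1..n. (\<bar>poly p (u i)\<bar> * sqrt (K (u i))) * (sqrt (K (u i)) / (real n * h)))\<^sup>2"
    using h Kd(3) by (intro arg_cong[where f = "\<lambda>x. x\<^sup>2"] sum.cong refl) (simp add: w_eq abs_mult)
  also have "\<dots> \<le> (\<Sum>i=1..n. (\<bar>poly p (u i)\<bar> * sqrt (K (u i)))\<^sup>2)
      * (\<Sum>i=1..n. (sqrt (K (u i)) / (real n * h))\<^sup>2)"
    by (rule Cauchy_Schwarz_ineq_sum)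
  also have "\<dots> = S * ((\<Sum>i=1..n. K (u i)) / (real n * h)\<^sup>2)"
    using Kd(3) by (simp add: S_def power_mult_distrib power_divide sum_divide_distrib)
  also have "\<dots> \<le> (real n * h * (CKmi * point_eval_const l)) * (CKma * (3 * (real n * h)) / (real n * h)\<^sup>2)"
    using Kd S0 h
    by (intro mult_mono S_le divide_right_mono K_sum divide_nonneg_nonneg sum_nonneg mult_nonneg_nonneg)
       (auto simp: point_eval_const_def)
  also have "\<dots> = 3 * (CKmi * CKma * point_eval_const l)"
    using N0 by (auto simp: power2_eq_square)
  finally show "(\<Sum>i=1..n. \<bar>lp_weight K l n h t i\<bar>)\<^sup>2 \<le> 3 * (CKmi * CKma * point_eval_const l)"
    by (simp add: w_def)
qed

lemma lp_weight_eq_0: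
  assumes "kernel_cond K CKmi CKma" "0 < h" "h < \<bar>design_point n i - t\<bar>"
  shows "lp_weight K l n h t i = 0"
proof -
  have "1 < \<bar>(design_point n i - t) / h\<bar>"
    using assms by simp
  then show ?thesis
    using kernel_condD(6)[OF assms(1)] by (simp add: lp_weight_def Let_def)
qed

section \<open>Reproduction of smooth functions\<close>

lemma strict_floor_less:
  assumes "0 < \<beta>"
  shows "real (strict_floor \<beta>) < \<beta>"
  unfolding strict_floor_def
proof (rule GreatestI_nat[where P = "\<lambda>k. real k < \<beta>" and b = "nat \<lceil>\<beta>\<rceil>"])
  show "real 0 < \<beta>" using assms by simp
  show "k \<le> nat \<lceil>\<beta>\<rceil>" if "real k < \<beta>" for k using that by linarith
qed

text \<open>Subtracting from \<open>f\<close> the term of degree \<open>l\<close> of its Taylor polynomial leaves a function whose \<open>l\<close>-th derivative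
\<open>D\<^sub>l(x) - D\<^sub>l(t)\<close> is controlled by the Hoelder condition; \<open>field_Taylor\<close> is applied to it at order \<open>l - 1\<close>, which is
where the factorial \<open>(l - 1)!\<close> comes from.\<close>

lemma hoelder_class_taylor:
  assumes f: "f \<in> hoelder_class \<beta> L" and \<beta>: "0 < \<beta>" and L: "0 \<le> L" and t: "t \<in> {0..1}"
    and l: "l = strict_floor \<beta>"
  obtains T :: "real poly" where "degree T \<le> l" "poly T 0 = f t"
    and "\<And>x. x \<in> {0..1} \<Longrightarrow> \<bar>f x - poly T (x - t)\<bar> \<le> L * \<bar>x - t\<bar> powr \<beta> / fact (l - 1)"
proof -
  from f obtain D where D0: "\<And>x. x \<in> {0..1} \<Longrightarrow> D 0 x = f x"
    and deriv: "\<And>k x. k < l \<Longrightarrow> x \<in> {0..1} \<Longrightarrow>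
        (D k has_real_derivative D (Suc k) x) (at x within {0..1})"
    and hoelder: "\<And>x t. x \<in> {0..1} \<Longrightarrow> t \<in> {0..1} \<Longrightarrow>
        \<bar>D l t - D l x\<bar> \<le> L * \<bar>x - t\<bar> powr (\<beta> - real l)"
    unfolding hoelder_class_def l by blast
  have l_less: "real l < \<beta>"
    unfolding l by (rule strict_floor_less) fact
  define T where "T = (\<Sum>i\<le>l. monom (D i t / fact i) i)"
  have T_eval: "poly T y = (\<Sum>i\<le>l. D i t * y ^ i / fact i)" for y
    by (simp add: T_def poly_sum poly_monom)
  have T_0: "poly T 0 = f t"
  proof -
    have "poly T 0 = (\<Sum>i\<le>l. if i = 0 then D i t else 0)"
      unfolding T_eval by (intro sum.cong) auto
    then show ?thesis
      using t by (simp add: D0)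
  qed
  show thesis
  proof
    show "degree T \<le> l"
      unfolding T_def by (intro degree_sum_le) (auto intro: order_trans[OF degree_monom_le])
    show "poly T 0 = f t" by (rule T_0)
    fix x :: real assume x: "x \<in> {0..1}"
    show "\<bar>f x - poly T (x - t)\<bar> \<le> L * \<bar>x - t\<bar> powr \<beta> / fact (l - 1)"
    proof (cases "l = 0 \<or> x = t")
      case True
      then show ?thesis
      proof
        assume "l = 0"
        then show ?thesis
          using hoelder[OF x t] D0 x t by (simp add: T_eval abs_minus_commute)
      next
        assume "x = t"
        then show ?thesis using T_0 by simp
      qed
    next
      case False
      then obtain m where m: "l = Suc m" and xt: "x \<noteq> t"
        by (cases l) auto
      define S where "S = closed_segment t x"
      have S: "S \<subseteq> {0..1}"
        unfolding S_def using x t by (intro closed_segment_subset) auto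
      \<comment> \<open>\<open>g 0\<close> is \<open>f\<close> minus that term of degree \<open>l\<close>, and \<open>g i\<close> its \<open>i\<close>-th derivative\<close>
      define g where "g i y = D i y - D l t * (y - t) ^ (l - i) / fact (l - i)" for i y
      have "norm (g 0 x - (\<Sum>i\<le>m. g i t * (x - t) ^ i / fact i))
          \<le> (L * \<bar>x - t\<bar> powr (\<beta> - real l)) * norm (x - t) ^ Suc m / fact m"
      proof (rule field_Taylor[where S = S])
        show "convex S" by (simp add: S_def)
        show "t \<in> S" "x \<in> S" by (simp_all add: S_def)
      next
        fix i y assume y: "y \<in> S" and i: "i \<le> m"
        define k where "k = l - Suc i"
        have i': "l - i = Suc k"
          using i m by (simp add: k_def)
        have "(D i has_real_derivative D (Suc i) y) (at y within S)"
          using deriv[of i y] i m y S by (blast intro: DERIV_subset le_imp_less_Suc)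
        moreover have "((\<lambda>y. D l t / fact (Suc k) * (y - t) ^ Suc k)
            has_real_derivative D l t / fact (Suc k) * (real (Suc k) * (y - t) ^ k)) (at y within S)"
          by (rule derivative_eq_intros refl | simp)+
        moreover have "D l t / fact (Suc k) * (real (Suc k) * (y - t) ^ k) = D l t * (y - t) ^ k / fact k"
          by (simp add: fact_Suc del: of_nat_Suc)
        ultimately show "(g i has_real_derivative g (Suc i) y) (at y within S)"
          unfolding g_def i' k_def[symmetric] by (auto dest: DERIV_diff)
      next
        fix y assume y: "y \<in> S"
        have "\<bar>D l y - D l t\<bar> \<le> L * \<bar>t - y\<bar> powr (\<beta> - real l)"
          using hoelder y S t by blast
        also have "\<dots> \<le> L * \<bar>x - t\<bar> powr (\<beta> - real l)"
          using y l_less unfolding S_def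
          by (intro mult_left_mono powr_mono2 L) (auto simp: closed_segment_eq_real_ivl split: if_splits)
        finally show "norm (g (Suc m) y) \<le> L * \<bar>x - t\<bar> powr (\<beta> - real l)"
          by (simp add: g_def m)
      qed
      also have "(\<Sum>i\<le>m. g i t * (x - t) ^ i / fact i) = (\<Sum>i\<le>m. D i t * (x - t) ^ i / fact i)"
        by (intro sum.cong refl) (simp add: g_def m)
      also have "g 0 x - (\<Sum>i\<le>m. D i t * (x - t) ^ i / fact i) = f x - poly T (x - t)"
        using x by (simp add: g_def T_eval m D0)
      also have "(L * \<bar>x - t\<bar> powr (\<beta> - real l)) * norm (x - t) ^ Suc m / fact m
          = L * \<bar>x - t\<bar> powr \<beta> / fact (l - 1)"
        using xt by (simp add: m powr_diff powr_add powr_realpow)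
      finally show ?thesis by simp
    qed
  qed
qed

text \<open>The weights reproduce the Taylor polynomial at \<open>t\<close>, so only the remainder survives, and the weights vanish
outside of the window of radius \<open>h\<close>.\<close>

lemma lp_weight_hoelder_bias:
  assumes inv: "invertible_mat (lp_matrix K l n h t)" and K: "kernel_cond K CKmi CKma"
    and t: "t \<in> {0..1}" and h: "0 < h" and \<beta>: "0 < \<beta>" and l: "l = strict_floor \<beta>"
    and f: "f \<in> hoelder_class \<beta> L" and L: "0 \<le> L"
  shows "\<bar>(\<Sum>i=1..n. lp_weight K l n h t i * f (design_point n i)) - f t\<bar>
    \<le> L * (h powr \<beta> * (\<Sum>i=1..n. \<bar>lp_weight K l n h t i\<bar>) / fact (l - 1))"
proof -
  define x where "x i = design_point n i" for i
  define w where "w i = lp_weight K l n h t i" for i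
  have x01: "x i \<in> {0..1}" if "i \<in> {1..n}" for i
    using that by (auto simp: x_def design_point_def divide_simps)
  from inv have repr: "\<And>q. degree q \<le> l \<Longrightarrow> (\<Sum>i=1..n. w i * poly q ((x i - t) / h)) = poly q 0"
    unfolding w_def x_def by (rule lp_weight_polynomial) blast
  from hoelder_class_taylor[OF f \<beta> L t l] obtain T where T: "degree T \<le> l" "poly T 0 = f t"
    and rem: "\<And>x. x \<in> {0..1} \<Longrightarrow> \<bar>f x - poly T (x - t)\<bar> \<le> L * \<bar>x - t\<bar> powr \<beta> / fact (l - 1)"
    by blast
  have "(\<Sum>i=1..n. w i * poly T (x i - t)) = f t"
    using repr[of "pcompose T [:0, h:]"] T h by (simp add: poly_pcompose degree_pcompose)
  then have "\<bar>(\<Sum>i=1..n. w i * f (x i)) - f t\<bar> = \<bar>\<Sum>i=1..n. w i * (f (x i) - poly T (x i - t))\<bar>"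
    by (simp add: right_diff_distrib sum_subtractf)
  also have "\<dots> \<le> (\<Sum>i=1..n. \<bar>w i * (f (x i) - poly T (x i - t))\<bar>)"
    by (rule sum_abs)
  also have "\<dots> \<le> (\<Sum>i=1..n. \<bar>w i\<bar> * (L * h powr \<beta> / fact (l - 1)))"
  proof (rule sum_mono)
    fix i assume i: "i \<in> {1..n}"
    show "\<bar>w i * (f (x i) - poly T (x i - t))\<bar> \<le> \<bar>w i\<bar> * (L * h powr \<beta> / fact (l - 1))"
    proof (cases "\<bar>x i - t\<bar> \<le> h")
      case True
      have "\<bar>f (x i) - poly T (x i - t)\<bar> \<le> L * \<bar>x i - t\<bar> powr \<beta> / fact (l - 1)"
        by (intro rem x01 i)
      also have "\<dots> \<le> L * h powr \<beta> / fact (l - 1)"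
        using True \<beta> by (intro divide_right_mono mult_left_mono powr_mono2 L) auto
      finally show ?thesis
        unfolding abs_mult by (rule mult_left_mono) simp
    next
      case False
      then have "w i = 0"
        unfolding w_def by (intro lp_weight_eq_0[OF K h]) (simp add: x_def)
      then show ?thesis by simp
    qed
  qed
  also have "\<dots> = L * (h powr \<beta> * (\<Sum>i=1..n. \<bar>w i\<bar>) / fact (l - 1))"
    by (simp add: sum_distrib_left sum_divide_distrib mult_ac)
  finally show ?thesis
    by (simp add: w_def x_def)
qed

section \<open>Generic chaining with a tail bound\<close>

lemma part_of_eqI:
  assumes "partition_on B \<A>" "T \<in> \<A>" "q \<in> T"
  shows "part_of \<A> q = T"
  unfolding part_of_def using assms by (intro the_equality) (auto simp: partition_on_def disjoint_def)

lemma part_of_mem: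
  assumes "partition_on B \<A>" "q \<in> B"
  shows "part_of \<A> q \<in> \<A>" "q \<in> part_of \<A> q"
proof -
  obtain T where "T \<in> \<A>" "q \<in> T"
    using assms by (auto simp: partition_on_def)
  then show "part_of \<A> q \<in> \<A>" "q \<in> part_of \<A> q"
    using part_of_eqI[OF assms(1)] by auto
qed

lemma dist_le_ediam: "p \<in> T \<Longrightarrow> q \<in> T \<Longrightarrow> ennreal (d p q) \<le> ediam d T"
  unfolding ediam_def by (blast intro: SUP_upper2)

text \<open>From a nearly optimal admissible sequence of partitions, \<open>c k q\<close> is a representative of the part of level
\<open>k\<close> containing \<open>q\<close>, with \<open>m\<close> as representative of the whole set. A link from level \<open>k\<close> to \<open>k + 1\<close> depends only on
the part of level \<open>k + 1\<close>, so the number of links is bounded by the number of parts.\<close>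

lemma chaining_net:
  assumes d: "\<And>p q. 0 \<le> d p q" and m: "m \<in> B" and \<gamma>: "gamma2 d B < ennreal g"
  obtains c :: "nat \<Rightarrow> 'a \<Rightarrow> 'a" where "\<And>q. c 0 q = m" and "\<And>k q. q \<in> B \<Longrightarrow> c k q \<in> B"
    and "\<And>k. finite ((\<lambda>q. (c (Suc k) q, c k q)) ` B)"
    and "\<And>k. card ((\<lambda>q. (c (Suc k) q, c k q)) ` B) \<le> 2 ^ 2 ^ Suc k"
    and "\<And>n q. q \<in> B \<Longrightarrow> (\<Sum>k<n. 2 powr (real k / 2) * d (c (Suc k) q) (c k q)) \<le> g"
    and "\<And>k q. q \<in> B \<Longrightarrow> 2 powr (real k / 2) * d q (c k q) \<le> g"
proof -
  from \<gamma> obtain A where A: "admissible B A"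
    and sup: "(SUP q\<in>B. \<Sum>k. ennreal (2 powr (real k / 2)) * ediam d (part_of (A k) q)) < ennreal g"
    unfolding gamma2_def INF_less_iff by auto
  have part: "partition_on B (A k)" and ref: "refines B (A (Suc k)) (A k)" and A0: "A 0 = {B}"
    and fin: "finite (A (Suc k))" and card_A: "card (A (Suc k)) \<le> 2 ^ 2 ^ Suc k" for k
    using A unfolding admissible_def by auto
  define R where "R k q = part_of (A k) q" for k q
  have R: "R k q \<in> A k" "q \<in> R k q" if "q \<in> B" for k q
    using part_of_mem[OF part that] by (simp_all add: R_def)
  have R_eq: "R k q = T" if "T \<in> A k" "q \<in> T" for k q T
    unfolding R_def by (rule part_of_eqI[OF part that])
  have R_sub: "R k q \<subseteq> B" if "q \<in> B" for k q
    using R(1)[OF that] part[of k] by (auto simp: partition_on_def)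
  have R_Suc: "R (Suc k) q \<subseteq> R k q" if q: "q \<in> B" for k q
  proof -
    obtain T where "T \<in> A k" "R (Suc k) q \<subseteq> T"
      using ref[of k] R(1)[OF q, of "Suc k"] unfolding refines_def by blast
    then show ?thesis
      using R_eq[of T k q] R(2)[OF q, of "Suc k"] by blast
  qed
  define c where "c k q = (if k = 0 then m else SOME p. p \<in> R k q)" for k :: nat and q
  have c_in: "c k q \<in> R k q" if q: "q \<in> B" for k q
  proof (cases "k = 0")
    case True
    have "R 0 q = B"
      using R(1)[OF q, of 0] A0 by simp
    then show ?thesis
      using True m by (simp add: c_def)
  next
    case False
    then show ?thesis
      using R(2)[OF q, of k] by (auto simp: c_def intro: someI)
  qed
  define \<phi> where "\<phi> k T = (let q = (SOME q. q \<in> T) in (c (Suc k) q, c k q))" for k :: nat and T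
  have pairs: "(\<lambda>q. (c (Suc k) q, c k q)) ` B \<subseteq> \<phi> k ` A (Suc k)" for k
  proof clarify
    fix q assume q: "q \<in> B"
    define q' where "q' = (SOME q'. q' \<in> R (Suc k) q)"
    have q': "q' \<in> R (Suc k) q"
      unfolding q'_def using R(2)[OF q] by (rule someI)
    have "R (Suc k) q' = R (Suc k) q"
      using R(1)[OF q] q' by (rule R_eq)
    moreover have "R k q' = R k q"
      using R(1)[OF q] q' R_Suc[OF q] by (intro R_eq) auto
    ultimately have "(c (Suc k) q, c k q) = \<phi> k (R (Suc k) q)"
      unfolding \<phi>_def q'_def[symmetric] by (simp add: c_def)
    then show "(c (Suc k) q, c k q) \<in> \<phi> k ` A (Suc k)"
      using R(1)[OF q] by blast
  qed
  have series: "(\<Sum>k. ennreal (2 powr (real k / 2)) * ediam d (R k q)) \<le> ennreal g" if "q \<in> B" for q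
    using SUP_lessD[OF sup that] unfolding R_def by simp
  have g: "0 \<le> g"
    using \<gamma> by (cases "0 \<le> g") (auto simp: ennreal_neg)
  have weighted: "ennreal (2 powr (real k / 2) * d a b) \<le> ennreal (2 powr (real k / 2)) * ediam d (R k q)"
    if "a \<in> R k q" "b \<in> R k q" for a b k q
    using dist_le_ediam[OF that, of d] d by (simp add: ennreal_mult mult_left_mono)
  show thesis
  proof
    show "c 0 q = m" for q by (simp add: c_def)
    show "c k q \<in> B" if "q \<in> B" for k q
      using c_in[OF that] R_sub[OF that] by blast
    show "finite ((\<lambda>q. (c (Suc k) q, c k q)) ` B)" for k
      using pairs fin by (rule finite_subset[OF _ finite_imageI])
    show "card ((\<lambda>q. (c (Suc k) q, c k q)) ` B) \<le> 2 ^ 2 ^ Suc k" for k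
      using surj_card_le[OF fin pairs] card_A by (rule order_trans)
    show "(\<Sum>k<n. 2 powr (real k / 2) * d (c (Suc k) q) (c k q)) \<le> g" if q: "q \<in> B" for n q
    proof -
      have "ennreal (\<Sum>k<n. 2 powr (real k / 2) * d (c (Suc k) q) (c k q))
          = (\<Sum>k<n. ennreal (2 powr (real k / 2) * d (c (Suc k) q) (c k q)))"
        using d by (simp add: sum_ennreal)
      also have "\<dots> \<le> (\<Sum>k<n. ennreal (2 powr (real k / 2)) * ediam d (R k q))"
        using c_in[OF q] R_Suc[OF q] by (intro sum_mono weighted) blast+
      also have "\<dots> \<le> (\<Sum>k. ennreal (2 powr (real k / 2)) * ediam d (R k q))"
        by (intro sum_le_suminf summableI) auto
      also have "\<dots> \<le> ennreal g"
        by (rule series[OF q])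
      finally show ?thesis
        unfolding ennreal_le_iff[OF g] .
    qed
    show "2 powr (real k / 2) * d q (c k q) \<le> g" if q: "q \<in> B" for k q
    proof -
      have "ennreal (2 powr (real k / 2) * d q (c k q)) \<le> ennreal (2 powr (real k / 2)) * ediam d (R k q)"
        using c_in[OF q] R(2)[OF q] by (intro weighted)
      also have "\<dots> = (\<Sum>k\<in>{k}. ennreal (2 powr (real k / 2)) * ediam d (R k q))"
        by simp
      also have "\<dots> \<le> (\<Sum>k. ennreal (2 powr (real k / 2)) * ediam d (R k q))"
        by (intro sum_le_suminf summableI) auto
      also have "\<dots> \<le> ennreal g"
        by (rule series[OF q])
      finally show ?thesis
        unfolding ennreal_le_iff[OF g] .
    qed
  qed
qed

text \<open>The threshold at level \<open>k\<close> grows like \<open>2 ^ (k / 2)\<close>, so the Gaussian tail \<open>exp (- u\<^sup>2 2 ^ k / 2)\<close> absorbs the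
\<open>2 ^ 2 ^ (k + 1)\<close> links as soon as \<open>u\<^sup>2 \<ge> 8\<close>, and the remainder is still geometric in \<open>k\<close>.\<close>

lemma union_bound_level:
  fixes u :: real
  assumes u: "8 \<le> u\<^sup>2"
  shows "2 ^ 2 ^ Suc k * (2 * exp (- ((u * 2 powr (real k / 2))\<^sup>2 / 2))) \<le> 2 * exp (- (u\<^sup>2 / 4)) * (1 / 2) ^ k"
proof -
  define z where "z = u\<^sup>2 / 4"
  have z: "2 \<le> z" "u\<^sup>2 = 4 * z"
    using u by (simp_all add: z_def)
  have sq: "(2 powr (real k / 2))\<^sup>2 = (2::real) ^ k"
    by (simp add: powr_powr powr_realpow flip: powr_numeral)
  have "(2::real) \<le> exp 1"
    using exp_ge_add_one_self[of 1] by simp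
  then have "(2::real) ^ 2 ^ Suc k \<le> exp 1 ^ 2 ^ Suc k"
    by (intro power_mono) auto
  also have "\<dots> = exp (2 * 2 ^ k)"
    by (simp flip: exp_of_nat_mult)
  finally have two: "(2::real) ^ 2 ^ Suc k \<le> exp (2 * 2 ^ k)" .
  have "real k + 1 \<le> 2 ^ k"
    using of_nat_mono[OF Suc_leI[OF less_exp[of k]], where ?'a = real] by simp
  then have k: "(real k + 1) * z \<le> 2 ^ k * z"
    using z by (intro mult_right_mono) auto
  have half: "exp (- z) \<le> 1 / 2"
  proof -
    have "exp (- z) \<le> exp (- 1)" using z by simp
    also have "\<dots> \<le> 1 / 2"
      using \<open>2 \<le> exp 1\<close> by (simp add: exp_minus field_simps)
    finally show ?thesis .
  qed
  have "2 ^ 2 ^ Suc k * (2 * exp (- ((u * 2 powr (real k / 2))\<^sup>2 / 2)))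
      \<le> exp (2 * 2 ^ k) * (2 * exp (- ((u * 2 powr (real k / 2))\<^sup>2 / 2)))"
    by (intro mult_right_mono two) auto
  also have "\<dots> = 2 * exp (2 * 2 ^ k - 2 * z * 2 ^ k)"
    unfolding power_mult_distrib sq z(2) by (simp flip: exp_add add: mult_ac)
  also have "\<dots> \<le> 2 * exp (- ((real k + 1) * z))"
  proof -
    have "2 * 2 ^ k \<le> z * 2 ^ k"
      using z by (intro mult_right_mono) auto
    then have "2 * 2 ^ k - 2 * z * 2 ^ k \<le> - ((real k + 1) * z)"
      using k by (simp only: mult.commute[of "2 ^ k" z])
    then show ?thesis by simp
  qed
  also have "\<dots> = 2 * exp (- z) * exp (- z) ^ k"
    by (simp add: algebra_simps flip: exp_add exp_of_nat_mult)
  also have "\<dots> \<le> 2 * exp (- z) * (1 / 2) ^ k"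
    using half by (intro mult_left_mono power_mono) auto
  finally show ?thesis
    by (simp add: z_def)
qed

text \<open>Outside of one exceptional event every link of every level respects its threshold, and then the supremum
over the possibly uncountable \<open>B\<close> is bounded deterministically by summing along the chains. The event is a
countable union over links, hence measurable, although the supremum itself need not be. The Lipschitz property
lets the chains converge.\<close>

lemma (in prob_space) generic_chaining_tail:
  fixes X :: "'b \<Rightarrow> 'a \<Rightarrow> real"
  assumes d: "\<And>p q. 0 \<le> d p q" and m: "m \<in> B" and \<gamma>: "gamma2 d B < ennreal g"
    and X [measurable]: "\<And>p. p \<in> B \<Longrightarrow> X p \<in> borel_measurable M"
    and increment: "\<And>p q v. p \<in> B \<Longrightarrow> q \<in> B \<Longrightarrow> 0 \<le> v \<Longrightarrow>
          prob {\<omega>\<in>space M. v * S * d p q < \<bar>X p \<omega> - X q \<omega>\<bar>} \<le> 2 * exp (- (v\<^sup>2 / 2))"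
    and lipschitz: "\<And>p q \<omega>. p \<in> B \<Longrightarrow> q \<in> B \<Longrightarrow> \<omega> \<in> space M \<Longrightarrow> \<bar>X p \<omega> - X q \<omega>\<bar> \<le> \<Lambda> * d p q"
    and S: "0 \<le> S" and u: "0 \<le> u" "8 \<le> u\<^sup>2"
  obtains E where "E \<in> events" "prob E \<le> 4 * exp (- (u\<^sup>2 / 4))"
    and "\<And>\<omega> q. \<omega> \<in> space M \<Longrightarrow> \<omega> \<notin> E \<Longrightarrow> q \<in> B \<Longrightarrow> \<bar>X q \<omega> - X m \<omega>\<bar> \<le> u * S * g"
proof -
  obtain c where c0: "\<And>q. c 0 q = m" and cB: "\<And>k q. q \<in> B \<Longrightarrow> c k q \<in> B"
    and fin: "\<And>k. finite ((\<lambda>q. (c (Suc k) q, c k q)) ` B)"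
    and card: "\<And>k. card ((\<lambda>q. (c (Suc k) q, c k q)) ` B) \<le> 2 ^ 2 ^ Suc k"
    and path: "\<And>n q. q \<in> B \<Longrightarrow> (\<Sum>k<n. 2 powr (real k / 2) * d (c (Suc k) q) (c k q)) \<le> g"
    and near: "\<And>k q. q \<in> B \<Longrightarrow> 2 powr (real k / 2) * d q (c k q) \<le> g"
    using chaining_net[of d, OF d m \<gamma>] by blast
  define J where "J k = (\<lambda>q. (c (Suc k) q, c k q)) ` B" for k
  define bad where "bad k z = {\<omega>\<in>space M. (u * 2 powr (real k / 2)) * S * d (fst z) (snd z)
      < \<bar>X (fst z) \<omega> - X (snd z) \<omega>\<bar>}" for k :: nat and z
  define E where "E = (\<Union>k. \<Union>z\<in>J k. bad k z)"
  have JB: "fst z \<in> B" "snd z \<in> B" if "z \<in> J k" for k z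
    using that cB by (auto simp: J_def)
  have bad_ev: "bad k z \<in> events" if "z \<in> J k" for k z
  proof -
    note [measurable] = X[OF JB(1)[OF that]] X[OF JB(2)[OF that]]
    show ?thesis unfolding bad_def by measurable
  qed
  have level_ev: "(\<Union>z\<in>J k. bad k z) \<in> events" for k
    using fin[of k] bad_ev unfolding J_def[symmetric] by (intro sets.finite_UN) auto
  have level: "prob (\<Union>z\<in>J k. bad k z) \<le> 2 * exp (- (u\<^sup>2 / 4)) * (1 / 2) ^ k" for k
  proof -
    have "prob (\<Union>z\<in>J k. bad k z) \<le> (\<Sum>z\<in>J k. prob (bad k z))"
      using fin[of k] bad_ev unfolding J_def[symmetric] by (intro measure_UNION_le) auto
    also have "\<dots> \<le> (\<Sum>z\<in>J k. 2 * exp (- ((u * 2 powr (real k / 2))\<^sup>2 / 2)))"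
      unfolding bad_def using JB u by (intro sum_mono increment) auto
    also have "\<dots> = real (card (J k)) * (2 * exp (- ((u * 2 powr (real k / 2))\<^sup>2 / 2)))"
      by simp
    also have "\<dots> \<le> 2 ^ 2 ^ Suc k * (2 * exp (- ((u * 2 powr (real k / 2))\<^sup>2 / 2)))"
    proof (rule mult_right_mono)
      have "real (card (J k)) \<le> real (2 ^ 2 ^ Suc k)"
        using card[of k] unfolding J_def of_nat_le_iff .
      then show "real (card (J k)) \<le> 2 ^ 2 ^ Suc k"
        by simp
    qed simp
    also have "\<dots> \<le> 2 * exp (- (u\<^sup>2 / 4)) * (1 / 2) ^ k"
      by (rule union_bound_level) (rule u)
    finally show ?thesis .
  qed
  have geo: "(\<lambda>k. 2 * exp (- (u\<^sup>2 / 4)) * (1 / 2) ^ k) sums (2 * exp (- (u\<^sup>2 / 4)) * 2)"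
    by (intro sums_mult) (use geometric_sums[of "1/2::real"] in simp)
  have summ: "summable (\<lambda>k. prob (\<Union>z\<in>J k. bad k z))"
    by (rule summable_comparison_test'[OF sums_summable[OF geo]]) (use level in simp)
  show thesis
  proof
    show "E \<in> events"
      unfolding E_def using level_ev by auto
    have "prob E \<le> (\<Sum>k. prob (\<Union>z\<in>J k. bad k z))"
      unfolding E_def using level_ev summ by (intro finite_measure_subadditive_countably) auto
    also have "\<dots> \<le> (\<Sum>k. 2 * exp (- (u\<^sup>2 / 4)) * (1 / 2) ^ k)"
      by (intro suminf_le level summ sums_summable[OF geo])
    also have "\<dots> = 4 * exp (- (u\<^sup>2 / 4))"
      using sums_unique[OF geo] by simp
    finally show "prob E \<le> 4 * exp (- (u\<^sup>2 / 4))" .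
  next
    fix \<omega> q assume \<omega>: "\<omega> \<in> space M" "\<omega> \<notin> E" and q: "q \<in> B"
    have step: "\<bar>X (c (Suc k) q) \<omega> - X (c k q) \<omega>\<bar> \<le> u * S * (2 powr (real k / 2) * d (c (Suc k) q) (c k q))" for k
    proof -
      have "(c (Suc k) q, c k q) \<in> J k"
        using q by (auto simp: J_def)
      then have "\<omega> \<notin> bad k (c (Suc k) q, c k q)"
        using \<omega>(2) by (auto simp: E_def)
      then show ?thesis
        using \<omega>(1) by (simp add: bad_def mult_ac not_less)
    qed
    have chain: "\<bar>X (c n q) \<omega> - X m \<omega>\<bar> \<le> u * S * g" for n
    proof -
      have "\<bar>X (c n q) \<omega> - X m \<omega>\<bar> = \<bar>\<Sum>k<n. X (c (Suc k) q) \<omega> - X (c k q) \<omega>\<bar>"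
        by (subst sum_lessThan_telescope) (simp add: c0)
      also have "\<dots> \<le> (\<Sum>k<n. \<bar>X (c (Suc k) q) \<omega> - X (c k q) \<omega>\<bar>)"
        by (rule sum_abs)
      also have "\<dots> \<le> (\<Sum>k<n. u * S * (2 powr (real k / 2) * d (c (Suc k) q) (c k q)))"
        by (intro sum_mono step)
      also have "\<dots> = u * S * (\<Sum>k<n. 2 powr (real k / 2) * d (c (Suc k) q) (c k q))"
        by (simp only: sum_distrib_left)
      also have "\<dots> \<le> u * S * g"
        using u S by (intro mult_left_mono path q) auto
      finally show ?thesis .
    qed
    have "(\<lambda>n. u * S * g + \<bar>\<Lambda>\<bar> * (g * (2 powr (- 1 / 2)) ^ n)) \<longlonglongrightarrow> u * S * g + \<bar>\<Lambda>\<bar> * (g * 0)"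
      by (intro tendsto_intros LIMSEQ_realpow_zero) (auto simp: powr_less_one)
    moreover have "\<bar>X q \<omega> - X m \<omega>\<bar> \<le> u * S * g + \<bar>\<Lambda>\<bar> * (g * (2 powr (- 1 / 2)) ^ n)" for n
    proof -
      have "(2 powr (- 1 / 2)) ^ n = (2::real) powr - (real n / 2)"
        by (simp add: powr_powr flip: powr_realpow)
      then have "d q (c n q) \<le> g * (2 powr (- 1 / 2)) ^ n"
        using near[OF q, of n] by (simp add: powr_minus field_simps)
      then have "\<bar>\<Lambda>\<bar> * d q (c n q) \<le> \<bar>\<Lambda>\<bar> * (g * (2 powr (- 1 / 2)) ^ n)"
        by (intro mult_left_mono) auto
      moreover have "\<Lambda> * d q (c n q) \<le> \<bar>\<Lambda>\<bar> * d q (c n q)"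
        by (intro mult_right_mono d) auto
      moreover have "\<bar>X q \<omega> - X (c n q) \<omega>\<bar> \<le> \<Lambda> * d q (c n q)"
        by (intro lipschitz q cB \<omega>)
      ultimately show ?thesis
        using chain[of n] by linarith
    qed
    ultimately show "\<bar>X q \<omega> - X m \<omega>\<bar> \<le> u * S * g"
      by (intro LIMSEQ_le_const) auto
  qed
qed

section \<open>Weighted empirical squared distances\<close>

lemma space_metric_borel:
  assumes "Metric_space Q d"
  shows "space (metric_borel Q d) = Q"
proof -
  interpret Metric_space Q d by fact
  have "{U. openin mtopology U} \<subseteq> Pow Q"
    by (auto simp: openin_mtopology)
  then show ?thesis
    unfolding metric_borel_def by (rule space_measure_of)
qed

lemma borel_measurable_dist [measurable]:
  assumes "Metric_space Q d" "q \<in> Q"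
  shows "(\<lambda>x. d x q) \<in> borel_measurable (metric_borel Q d)"
proof -
  interpret Metric_space Q d by fact
  have "{x \<in> space (metric_borel Q d). d x q < a} \<in> sets (metric_borel Q d)" for a
  proof -
    have "{x \<in> space (metric_borel Q d). d x q < a} = mball q a"
      using assms by (auto simp: space_metric_borel commute)
    moreover have "mball q a \<in> sets (metric_borel Q d)"
      unfolding metric_borel_def
    proof (rule in_measure_of)
      show "{U. openin mtopology U} \<subseteq> Pow Q" by (auto simp: openin_mtopology)
    qed simp
    ultimately show ?thesis by simp
  qed
  then show ?thesis
    by (simp add: borel_measurable_iff_less)
qed

lemma abs_diff_squared_dist_le:
  assumes "Metric_space Q d" "y \<in> Q" "p \<in> Q" "q \<in> Q" and D: "\<And>p q. p \<in> Q \<Longrightarrow> q \<in> Q \<Longrightarrow> d p q \<le> D"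
  shows "\<bar>(d y p)\<^sup>2 - (d y q)\<^sup>2\<bar> \<le> 2 * D * d p q"
proof -
  interpret Metric_space Q d by fact
  have "\<bar>d y p - d y q\<bar> \<le> d p q"
    using triangle[of y p q] triangle[of y q p] assms(2-4) commute[of p q] by linarith
  moreover have "d y p + d y q \<le> 2 * D"
    using D[of y p] D[of y q] assms(2-4) by linarith
  ultimately have "\<bar>d y p - d y q\<bar> * (d y p + d y q) \<le> d p q * (2 * D)"
    by (intro mult_mono) auto
  moreover have "(d y p)\<^sup>2 - (d y q)\<^sup>2 = (d y p - d y q) * (d y p + d y q)"
    by (simp add: power2_eq_square algebra_simps)
  ultimately show ?thesis
    by (simp add: abs_mult mult_ac)
qed

definition (in prob_space) weighted_dev ::
    "('b \<Rightarrow> 'b \<Rightarrow> real) \<Rightarrow> (nat \<Rightarrow> 'a \<Rightarrow> 'b) \<Rightarrow> (nat \<Rightarrow> real) \<Rightarrow> nat \<Rightarrow> 'b \<Rightarrow> 'a \<Rightarrow> real" where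
  "weighted_dev d y w n q \<omega> =
     (\<Sum>i=1..n. w i * ((d (y i \<omega>) q)\<^sup>2 - expectation (\<lambda>\<omega>. (d (y i \<omega>) q)\<^sup>2)))"

context prob_space
begin

lemma bounded_dist_integrable:
  assumes "Metric_space Q d" "y \<in> measurable M (metric_borel Q d)" "q \<in> Q"
    and D: "\<And>p q. p \<in> Q \<Longrightarrow> q \<in> Q \<Longrightarrow> d p q \<le> D"
  shows "integrable M (\<lambda>\<omega>. (d (y \<omega>) q)\<^sup>2)"
proof (rule integrable_const_bound)
  interpret Metric_space Q d by fact
  note [measurable] = assms(2) borel_measurable_dist[OF assms(1,3)]
  show "(\<lambda>\<omega>. (d (y \<omega>) q)\<^sup>2) \<in> borel_measurable M" by measurable
  have "y \<omega> \<in> Q" if "\<omega> \<in> space M" for \<omega>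
    using measurable_space[OF assms(2) that] by (simp add: space_metric_borel[OF assms(1)])
  then show "AE \<omega> in M. norm ((d (y \<omega>) q)\<^sup>2) \<le> D\<^sup>2"
    using D assms(3) by (intro AE_I2) (auto intro!: power_mono)
qed

context
  fixes Q :: "'b set" and d and y :: "nat \<Rightarrow> 'a \<Rightarrow> 'b" and w :: "nat \<Rightarrow> real" and n
  assumes Q: "Metric_space Q d" and indep: "indep_vars (\<lambda>_. metric_borel Q d) y {1..n}"
begin

interpretation Metric_space Q d by (rule Q)

lemma sample_measurable: "i \<in> {1..n} \<Longrightarrow> y i \<in> measurable M (metric_borel Q d)"
  using indep unfolding indep_vars_def by auto

lemma sample_in: "i \<in> {1..n} \<Longrightarrow> \<omega> \<in> space M \<Longrightarrow> y i \<omega> \<in> Q"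
  using measurable_space[OF sample_measurable] by (simp add: space_metric_borel[OF Q])

lemma weighted_dev_measurable:
  assumes "q \<in> Q"
  shows "weighted_dev d y w n q \<in> borel_measurable M"
  unfolding weighted_dev_def
proof (rule borel_measurable_sum)
  fix i assume i: "i \<in> {1..n}"
  note [measurable] = sample_measurable[OF i] borel_measurable_dist[OF Q assms]
  show "(\<lambda>\<omega>. w i * ((d (y i \<omega>) q)\<^sup>2 - expectation (\<lambda>\<omega>. (d (y i \<omega>) q)\<^sup>2))) \<in> borel_measurable M"
    by measurable
qed

context
  fixes D
  assumes D: "\<And>p q. p \<in> Q \<Longrightarrow> q \<in> Q \<Longrightarrow> d p q \<le> D"
begin

lemma weighted_dev_diff:
  assumes "p \<in> Q" "q \<in> Q"
  shows "weighted_dev d y w n p \<omega> - weighted_dev d y w n q \<omega>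
    = (\<Sum>i=1..n. w i * ((d (y i \<omega>) p)\<^sup>2 - (d (y i \<omega>) q)\<^sup>2))
      - (\<Sum>i=1..n. expectation (\<lambda>\<omega>. w i * ((d (y i \<omega>) p)\<^sup>2 - (d (y i \<omega>) q)\<^sup>2)))"
proof -
  have mean: "expectation (\<lambda>\<omega>. w i * ((d (y i \<omega>) p)\<^sup>2 - (d (y i \<omega>) q)\<^sup>2))
      = w i * (expectation (\<lambda>\<omega>. (d (y i \<omega>) p)\<^sup>2) - expectation (\<lambda>\<omega>. (d (y i \<omega>) q)\<^sup>2))"
    if i: "i \<in> {1..n}" for i
    using bounded_dist_integrable[OF Q sample_measurable[OF i] _ D] assms by simp
  show ?thesis
    unfolding weighted_dev_def sum_subtractf[symmetric]
    by (intro sum.cong refl, subst mean) (simp_all add: algebra_simps)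
qed

lemma weighted_dev_lipschitz:
  assumes "p \<in> Q" "q \<in> Q" "\<omega> \<in> space M"
  shows "\<bar>weighted_dev d y w n p \<omega> - weighted_dev d y w n q \<omega>\<bar>
    \<le> 4 * D * (\<Sum>i=1..n. \<bar>w i\<bar>) * d p q"
proof -
  have bound: "\<bar>w i * ((d (y i \<omega>) p)\<^sup>2 - (d (y i \<omega>) q)\<^sup>2)\<bar> \<le> \<bar>w i\<bar> * (2 * D * d p q)"
    if "i \<in> {1..n}" "\<omega> \<in> space M" for i \<omega>
    unfolding abs_mult using that assms sample_in D
    by (intro mult_left_mono abs_diff_squared_dist_le[OF Q]) auto
  have "\<bar>\<Sum>i=1..n. w i * ((d (y i \<omega>) p)\<^sup>2 - (d (y i \<omega>) q)\<^sup>2)\<bar> \<le> (\<Sum>i=1..n. \<bar>w i\<bar> * (2 * D * d p q))"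
    by (intro order_trans[OF sum_abs] sum_mono bound assms)
  moreover have "\<bar>\<Sum>i=1..n. expectation (\<lambda>\<omega>. w i * ((d (y i \<omega>) p)\<^sup>2 - (d (y i \<omega>) q)\<^sup>2))\<bar>
      \<le> (\<Sum>i=1..n. \<bar>w i\<bar> * (2 * D * d p q))"
  proof (intro order_trans[OF sum_abs] sum_mono)
    fix i assume i: "i \<in> {1..n}"
    let ?f = "\<lambda>\<omega>. w i * ((d (y i \<omega>) p)\<^sup>2 - (d (y i \<omega>) q)\<^sup>2)"
    have "integrable M ?f"
      using bounded_dist_integrable[OF Q sample_measurable[OF i] _ D] assms by simp
    then have "expectation (\<lambda>\<omega>. \<bar>?f \<omega>\<bar>) \<le> expectation (\<lambda>_. \<bar>w i\<bar> * (2 * D * d p q))"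
      by (intro integral_mono bound i) auto
    then show "\<bar>expectation ?f\<bar> \<le> \<bar>w i\<bar> * (2 * D * d p q)"
      using integral_abs_bound[of M ?f] by (simp add: prob_space)
  qed
  ultimately have "\<bar>weighted_dev d y w n p \<omega> - weighted_dev d y w n q \<omega>\<bar>
      \<le> 2 * (\<Sum>i=1..n. \<bar>w i\<bar> * (2 * D * d p q))"
    unfolding weighted_dev_diff[OF assms(1,2)] by linarith
  also have "\<dots> = 4 * D * (\<Sum>i=1..n. \<bar>w i\<bar>) * d p q"
    by (simp add: sum_distrib_left sum_distrib_right mult_ac)
  finally show ?thesis .
qed

text \<open>Hoeffding's inequality for the summands \<open>w\<^sub>i (d(y\<^sub>i,p)\<^sup>2 - d(y\<^sub>i,q)\<^sup>2)\<close>, which lie between \<open>\<plusminus> 2 D \<bar>w\<^sub>i\<bar> d(p,q)\<close>. If all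
these ranges vanish, the increment is identically 0.\<close>

lemma weighted_dev_increment:
  assumes V: "(\<Sum>i=1..n. (w i)\<^sup>2) \<le> V" and pq: "p \<in> Q" "q \<in> Q" and v: "0 \<le> v"
  shows "prob {\<omega>\<in>space M. v * (2 * sqrt V * D) * d p q
            < \<bar>weighted_dev d y w n p \<omega> - weighted_dev d y w n q \<omega>\<bar>} \<le> 2 * exp (- (v\<^sup>2 / 2))"
proof -
  define Z where "Z i \<omega> = w i * ((d (y i \<omega>) p)\<^sup>2 - (d (y i \<omega>) q)\<^sup>2)" for i \<omega>
  define a where "a i = \<bar>w i\<bar> * (2 * D * d p q)" for i
  have Z_bound: "\<bar>Z i \<omega>\<bar> \<le> a i" if "i \<in> {1..n}" "\<omega> \<in> space M" for i \<omega>
    unfolding Z_def a_def abs_mult using that pq sample_in D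
    by (intro mult_left_mono abs_diff_squared_dist_le[OF Q]) auto
  have D0: "0 \<le> D"
    by (rule order_trans[OF nonneg D[OF pq(1) pq(1)]])
  have V0: "0 \<le> V"
    using V sum_nonneg[of "{1..n}" "\<lambda>i. (w i)\<^sup>2"] by simp
  have indep_Z: "indep_vars (\<lambda>_. borel) Z {1..n}"
    unfolding Z_def
  proof (rule indep_vars_compose2[OF indep])
    fix i
    note [measurable] = borel_measurable_dist[OF Q pq(1)] borel_measurable_dist[OF Q pq(2)]
    show "(\<lambda>x. w i * ((d x p)\<^sup>2 - (d x q)\<^sup>2)) \<in> borel_measurable (metric_borel Q d)"
      by measurable
  qed
  interpret H: Hoeffding_ineq M "{1..n}" Z "\<lambda>i. - a i" a "\<Sum>i=1..n. expectation (Z i)"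
  proof unfold_locales
    fix i assume "i \<in> {1..n}"
    then show "AE \<omega> in M. Z i \<omega> \<in> {- a i..a i}"
      using Z_bound by (intro AE_I2) (fastforce simp: abs_le_iff)
  qed (use indep_Z in auto)
  define \<epsilon> where "\<epsilon> = v * (2 * sqrt V * D) * d p q"
  have \<epsilon>0: "0 \<le> \<epsilon>"
    using v V0 D0 by (simp add: \<epsilon>_def)
  define W where "W = (\<Sum>i=1..n. (a i - - a i)\<^sup>2)"
  have W_le: "W \<le> 16 * (D * d p q)\<^sup>2 * V"
  proof -
    have "W = 16 * (D * d p q)\<^sup>2 * (\<Sum>i=1..n. (w i)\<^sup>2)"
      unfolding W_def sum_distrib_left
      by (intro sum.cong refl) (simp add: a_def power_mult_distrib)
    also have "\<dots> \<le> 16 * (D * d p q)\<^sup>2 * V"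
      by (intro mult_left_mono V) auto
    finally show ?thesis .
  qed
  have dev: "weighted_dev d y w n p \<omega> - weighted_dev d y w n q \<omega>
      = (\<Sum>i=1..n. Z i \<omega>) - (\<Sum>i=1..n. expectation (Z i))" for \<omega>
    using weighted_dev_diff[OF pq] by (simp add: Z_def[abs_def])
  show ?thesis
  proof (cases "W = 0")
    case True
    then have "a i = 0" if "i \<in> {1..n}" for i
      using that by (auto simp: W_def sum_nonneg_eq_0_iff)
    then have Z0: "Z i \<omega> = 0" if "i \<in> {1..n}" "\<omega> \<in> space M" for i \<omega>
      using Z_bound[OF that] that by simp
    then have "expectation (Z i) = 0" if "i \<in> {1..n}" for i
      using that by (simp cong: Bochner_Integration.integral_cong)
    then have "{\<omega>\<in>space M. \<epsilon> < \<bar>weighted_dev d y w n p \<omega> - weighted_dev d y w n q \<omega>\<bar>} = {}"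
      using \<epsilon>0 Z0 unfolding dev by auto
    then show ?thesis
      unfolding \<epsilon>_def[symmetric] by (simp only: measure_empty) simp
  next
    case False
    then have W0: "0 < W"
      unfolding W_def by (simp add: order_less_le sum_nonneg)
    have "prob {\<omega>\<in>space M. \<epsilon> < \<bar>weighted_dev d y w n p \<omega> - weighted_dev d y w n q \<omega>\<bar>}
        \<le> prob {\<omega>\<in>space M. \<epsilon> \<le> \<bar>(\<Sum>i=1..n. Z i \<omega>) - (\<Sum>i=1..n. expectation (Z i))\<bar>}"
      unfolding dev by (intro finite_measure_mono) auto
    also have "\<dots> \<le> 2 * exp (- 2 * \<epsilon>\<^sup>2 / W)"
      using H.Hoeffding_ineq_abs_ge[OF \<epsilon>0] W0 by (simp add: W_def)
    also have "\<dots> \<le> 2 * exp (- (v\<^sup>2 / 2))"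
    proof -
      have "v\<^sup>2 / 2 * W \<le> v\<^sup>2 / 2 * (16 * (D * d p q)\<^sup>2 * V)"
        by (intro mult_left_mono W_le) auto
      also have "\<dots> = 2 * \<epsilon>\<^sup>2"
        using V0 by (simp add: \<epsilon>_def power_mult_distrib)
      finally have "v\<^sup>2 / 2 \<le> 2 * \<epsilon>\<^sup>2 / W"
        using W0 by (simp add: le_divide_eq)
      then show ?thesis by simp
    qed
    finally show ?thesis
      unfolding \<epsilon>_def[symmetric] .
  qed
qed

end

end

end

section \<open>From tails at every scale to a second moment\<close>

lemma ediam_ball_le:
  assumes Q: "Metric_space Q d" and m: "m \<in> Q"
  shows "ediam d {q \<in> Q. d q m \<le> r} \<le> ennreal (2 * r)"
proof -
  interpret Metric_space Q d by fact
  have "d p q \<le> 2 * r" if "p \<in> Q" "q \<in> Q" "d p m \<le> r" "d q m \<le> r" for p q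
    using triangle[of p m q] that m commute[of m q] by auto
  then show ?thesis
    unfolding ediam_def by (intro SUP_least ennreal_leI) auto
qed

lemma mult_exp_minus_le:
  assumes "0 < (z::real)"
  shows "z * exp (- z) \<le> 2 / z"
proof -
  have "z\<^sup>2 / 2 \<le> exp z"
    using exp_lower_Taylor_quadratic[of z] assms by simp
  then show ?thesis
    using assms by (simp add: exp_minus field_simps power2_eq_square)
qed

text \<open>If \<open>x = d(mhat,m)\<close> exceeds \<open>2 C b\<close>, the linear term of the basic inequality can be absorbed into the left side, and
\<open>x\<^sup>2 \<le> 2 C \<bar>X mhat - X m\<bar>\<close>. On the shell \<open>r\<^sub>j < x \<le> r\<^sub>j\<^sub>+\<^sub>1\<close> with \<open>r\<^sub>j = 2 ^ j \<delta>\<close> this contradicts the chaining bound for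
the ball of radius \<open>r\<^sub>j\<^sub>+\<^sub>1\<close> at level \<open>u = 2 ^ (j + 2)\<close>, except on an event of probability at most
\<open>4 exp (- 4 ^ (j + 1))\<close>. These probabilities outweigh the factors \<open>r\<^sub>j\<^sub>+\<^sub>1\<^sup>2\<close>, so the shells contribute a multiple of
\<open>\<delta>\<^sup>2\<close>. A mere second moment of the supremum would give a divergent sum over the shells.\<close>

lemma (in prob_space) peeling_second_moment:
  fixes X :: "'b \<Rightarrow> 'a \<Rightarrow> real"
  assumes Q: "Metric_space Q d" and m: "m \<in> Q" and D: "\<And>p q. p \<in> Q \<Longrightarrow> q \<in> Q \<Longrightarrow> d p q \<le> D"
    and ent: "entropy_cond Q d CEnt"
    and mhat: "mhat \<in> measurable M (metric_borel Q d)"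
    and X: "\<And>p. p \<in> Q \<Longrightarrow> X p \<in> borel_measurable M"
    and increment: "\<And>p q v. p \<in> Q \<Longrightarrow> q \<in> Q \<Longrightarrow> 0 \<le> v \<Longrightarrow>
          prob {\<omega>\<in>space M. v * S * d p q < \<bar>X p \<omega> - X q \<omega>\<bar>} \<le> 2 * exp (- (v\<^sup>2 / 2))"
    and lipschitz: "\<And>p q \<omega>. p \<in> Q \<Longrightarrow> q \<in> Q \<Longrightarrow> \<omega> \<in> space M \<Longrightarrow> \<bar>X p \<omega> - X q \<omega>\<bar> \<le> \<Lambda> * d p q"
    and S: "0 < S" and C: "1 \<le> C" and b: "0 \<le> b"
    and basic: "\<And>\<omega>. \<omega> \<in> space M \<Longrightarrow>
          (d (mhat \<omega>) m)\<^sup>2 \<le> C * (b * d (mhat \<omega>) m + \<bar>X (mhat \<omega>) \<omega> - X m \<omega>\<bar>)"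
  shows "expectation (\<lambda>\<omega>. (d (mhat \<omega>) m)\<^sup>2) \<le> 4 * C\<^sup>2 * b\<^sup>2 + 4 * (48 * C * S * CEnt)\<^sup>2"
proof -
  interpret Q: Metric_space Q d by fact
  have CEnt: "1 \<le> CEnt" and \<gamma>: "\<And>B. B \<subseteq> Q \<Longrightarrow> B \<noteq> {} \<Longrightarrow> gamma2 d B \<le> ennreal CEnt * ediam d B"
    using ent unfolding entropy_cond_def by auto
  \<comment> \<open>the value for which \<open>2 C\<close> times the chaining bound on the ball of radius \<open>r (j + 1)\<close> equals \<open>(r j)\<^sup>2\<close>\<close>
  define \<delta> where "\<delta> = 48 * C * S * CEnt"
  have \<delta>: "0 < \<delta>"
    using S C CEnt by (simp add: \<delta>_def)
  define r where "r j = 2 ^ j * \<delta>" for j :: nat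
  have r: "0 < r j" for j
    using \<delta> by (simp add: r_def)
  define x where "x \<omega> = d (mhat \<omega>) m" for \<omega>
  have mhat_in: "mhat \<omega> \<in> Q" if "\<omega> \<in> space M" for \<omega>
    using measurable_space[OF mhat that] by (simp add: space_metric_borel[OF Q])
  have "\<exists>E. E \<in> events \<and> prob E \<le> 4 * exp (- (4 ^ Suc j)) \<and>
      (\<forall>\<omega> q. \<omega> \<in> space M \<longrightarrow> \<omega> \<notin> E \<longrightarrow> q \<in> Q \<longrightarrow> d q m \<le> r (Suc j) \<longrightarrow>
        \<bar>X q \<omega> - X m \<omega>\<bar> \<le> 2 ^ (j + 2) * S * (3 * CEnt * r (Suc j)))" for j
  proof -
    define B where "B = {q \<in> Q. d q m \<le> r (Suc j)}"
    have B: "B \<subseteq> Q" "m \<in> B"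
      using m r[of "Suc j"] by (auto simp: B_def)
    have "gamma2 d B \<le> ennreal CEnt * ediam d B"
      by (rule \<gamma>) (use B in auto)
    also have "\<dots> \<le> ennreal CEnt * ennreal (2 * r (Suc j))"
      unfolding B_def by (intro mult_left_mono ediam_ball_le Q m) simp
    also have "\<dots> = ennreal (2 * CEnt * r (Suc j))"
      using CEnt r[of "Suc j"] by (simp add: mult_ac flip: ennreal_mult)
    \<comment> \<open>the factor 3 instead of 2 leaves room for a partition sequence that only approximates the infimum\<close>
    also have "\<dots> < ennreal (3 * CEnt * r (Suc j))"
      using CEnt r[of "Suc j"] by (intro ennreal_lessI) auto
    finally have \<gamma>B: "gamma2 d B < ennreal (3 * CEnt * r (Suc j))" .
    have sq: "((2::real) ^ (j + 2))\<^sup>2 / 4 = 4 ^ Suc j"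
      by (simp add: power2_eq_square flip: power_mult_distrib)
    have "(1::real) \<le> 4 ^ j" by simp
    then have u8: "8 \<le> ((2::real) ^ (j + 2))\<^sup>2"
      using sq unfolding power_Suc by linarith
    have "\<exists>E. E \<in> events \<and> prob E \<le> 4 * exp (- (((2::real) ^ (j + 2))\<^sup>2 / 4)) \<and>
      (\<forall>\<omega> q. \<omega> \<in> space M \<longrightarrow> \<omega> \<notin> E \<longrightarrow> q \<in> B \<longrightarrow>
        \<bar>X q \<omega> - X m \<omega>\<bar> \<le> 2 ^ (j + 2) * S * (3 * CEnt * r (Suc j)))"
    proof (rule generic_chaining_tail[where d = d and X = X and B = B and m = m and S = S and \<Lambda> = \<Lambda>
            and u = "2 ^ (j + 2)", OF _ B(2) \<gamma>B])
      show "0 \<le> d p q" for p q by simp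
      show "X p \<in> borel_measurable M" if "p \<in> B" for p
        using that B by (intro X) auto
      show "prob {\<omega>\<in>space M. v * S * d p q < \<bar>X p \<omega> - X q \<omega>\<bar>} \<le> 2 * exp (- (v\<^sup>2 / 2))"
        if "p \<in> B" "q \<in> B" "0 \<le> v" for p q v
        using that B by (intro increment) auto
      show "\<bar>X p \<omega> - X q \<omega>\<bar> \<le> \<Lambda> * d p q" if "p \<in> B" "q \<in> B" "\<omega> \<in> space M" for p q \<omega>
        using that B by (intro lipschitz) auto
      show "0 \<le> S" "0 \<le> (2::real) ^ (j + 2)"
        using S by simp_all
      show "8 \<le> ((2::real) ^ (j + 2))\<^sup>2" by (rule u8)
    qed blast
    then show ?thesis
      unfolding sq B_def by blast
  qed
  then obtain E where E: "\<And>j. E j \<in> events" "\<And>j. prob (E j) \<le> 4 * exp (- (4 ^ Suc j))"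
    and sup: "\<And>j \<omega> q. \<omega> \<in> space M \<Longrightarrow> \<omega> \<notin> E j \<Longrightarrow> q \<in> Q \<Longrightarrow> d q m \<le> r (Suc j) \<Longrightarrow>
        \<bar>X q \<omega> - X m \<omega>\<bar> \<le> 2 ^ (j + 2) * S * (3 * CEnt * r (Suc j))"
    by metis
  obtain J where J: "D < r J"
  proof -
    obtain J where "D / \<delta> < 2 ^ J"
      using real_arch_pow[of 2 "D / \<delta>"] by auto
    then have "D < r J"
      using \<delta> by (simp add: r_def divide_less_eq)
    then show thesis by (rule that)
  qed
  have pointwise: "(x \<omega>)\<^sup>2 \<le> 4 * C\<^sup>2 * b\<^sup>2 + \<delta>\<^sup>2 + (\<Sum>j<J. (r (Suc j))\<^sup>2 * indicator (E j) \<omega>)"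
    if \<omega>: "\<omega> \<in> space M" for \<omega>
  proof -
    have rest: "0 \<le> (\<Sum>j<J. (r (Suc j))\<^sup>2 * indicator (E j) \<omega>)"
      by (intro sum_nonneg) auto
    have x0: "0 \<le> x \<omega>" by (simp add: x_def)
    have xD: "x \<omega> \<le> D"
      using D mhat_in[OF \<omega>] m by (simp add: x_def)
    consider "x \<omega> \<le> 2 * C * b" | "x \<omega> \<le> \<delta>" | "2 * C * b < x \<omega>" "\<delta> < x \<omega>"
      by linarith
    then show ?thesis
    proof cases
      case 1
      then have "(x \<omega>)\<^sup>2 \<le> (2 * C * b)\<^sup>2"
        using x0 by (intro power_mono)
      then show ?thesis
        using rest by (simp add: power_mult_distrib) (use zero_le_power2[of \<delta>] in linarith)
    next
      case 2
      then have "(x \<omega>)\<^sup>2 \<le> \<delta>\<^sup>2"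
        using x0 by (intro power_mono)
      moreover have "0 \<le> 4 * C\<^sup>2 * b\<^sup>2" by simp
      ultimately show ?thesis
        using rest by linarith
    next
      case 3
      define k where "k = (LEAST k. x \<omega> \<le> r k)"
      have k: "x \<omega> \<le> r k"
        unfolding k_def by (rule LeastI[of _ J]) (use xD J in linarith)
      have k_J: "k \<le> J"
        unfolding k_def by (rule Least_le) (use xD J in linarith)
      have "k \<noteq> 0"
        using k 3 by (intro notI) (simp add: r_def)
      then obtain j where j: "k = Suc j"
        by (cases k) auto
      have above: "r j < x \<omega>"
        using not_less_Least[of j "\<lambda>k. x \<omega> \<le> r k"] j unfolding k_def by simp
      have "\<omega> \<in> E j"
      proof (rule ccontr)
        assume "\<omega> \<notin> E j"
        then have dev: "\<bar>X (mhat \<omega>) \<omega> - X m \<omega>\<bar> \<le> 2 ^ (j + 2) * S * (3 * CEnt * r (Suc j))"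
          using sup[OF \<omega>] mhat_in[OF \<omega>] k by (simp add: x_def j)
        have "C * b * x \<omega> \<le> x \<omega> / 2 * x \<omega>"
          using 3 x0 by (intro mult_right_mono) auto
        then have "(x \<omega>)\<^sup>2 \<le> 2 * C * \<bar>X (mhat \<omega>) \<omega> - X m \<omega>\<bar>"
          using basic[OF \<omega>] by (simp add: x_def[symmetric] algebra_simps power2_eq_square)
        also have "\<dots> \<le> 2 * C * (2 ^ (j + 2) * S * (3 * CEnt * r (Suc j)))"
          using C by (intro mult_left_mono dev) auto
        also have "\<dots> = (r j)\<^sup>2"
          by (simp add: r_def \<delta>_def power2_eq_square)
        finally show False
          using above r[of j] power_strict_mono[of "r j" "x \<omega>" 2] by auto
      qed
      have "(x \<omega>)\<^sup>2 \<le> (r (Suc j))\<^sup>2"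
        using k x0 by (intro power_mono) (simp_all add: j)
      also have "\<dots> = (r (Suc j))\<^sup>2 * indicator (E j) \<omega>"
        using \<open>\<omega> \<in> E j\<close> by simp
      also have "\<dots> \<le> (\<Sum>j<J. (r (Suc j))\<^sup>2 * indicator (E j) \<omega>)"
        using k_J j by (intro member_le_sum) auto
      moreover have "0 \<le> 4 * C\<^sup>2 * b\<^sup>2 + \<delta>\<^sup>2" by simp
      ultimately show ?thesis by linarith
    qed
  qed
  have int_x: "integrable M (\<lambda>\<omega>. (x \<omega>)\<^sup>2)"
    unfolding x_def using bounded_dist_integrable[OF Q mhat m D] .
  have int_E: "integrable M (\<lambda>\<omega>. (r (Suc j))\<^sup>2 * indicator (E j) \<omega>)" for j
    using E(1) by (intro integrable_mult_right) (simp add: integrable_indicator_iff less_top[symmetric])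
  have level: "(r (Suc j))\<^sup>2 * prob (E j) \<le> 2 * \<delta>\<^sup>2 * (1 / 4) ^ j" for j
  proof -
    have "(r (Suc j))\<^sup>2 * prob (E j) \<le> (r (Suc j))\<^sup>2 * (4 * exp (- (4 ^ Suc j)))"
      by (intro mult_left_mono E) auto
    also have "\<dots> = 4 * \<delta>\<^sup>2 * (4 ^ Suc j * exp (- (4 ^ Suc j)))"
    proof -
      have "(r (Suc j))\<^sup>2 = 4 ^ Suc j * \<delta>\<^sup>2"
        by (simp add: r_def power2_eq_square flip: power_mult_distrib)
      then show ?thesis by simp
    qed
    also have "\<dots> \<le> 4 * \<delta>\<^sup>2 * (2 / 4 ^ Suc j)"
      by (intro mult_left_mono mult_exp_minus_le) auto
    also have "\<dots> = 2 * \<delta>\<^sup>2 * (1 / 4) ^ j"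
      by (simp add: power_divide)
    finally show ?thesis .
  qed
  have "expectation (\<lambda>\<omega>. (x \<omega>)\<^sup>2)
      \<le> expectation (\<lambda>\<omega>. 4 * C\<^sup>2 * b\<^sup>2 + \<delta>\<^sup>2 + (\<Sum>j<J. (r (Suc j))\<^sup>2 * indicator (E j) \<omega>))"
    by (intro integral_mono int_x pointwise Bochner_Integration.integrable_add
        Bochner_Integration.integrable_sum int_E) auto
  also have "\<dots> = 4 * C\<^sup>2 * b\<^sup>2 + \<delta>\<^sup>2 + (\<Sum>j<J. (r (Suc j))\<^sup>2 * prob (E j))"
  proof -
    have "expectation (\<lambda>\<omega>. 4 * C\<^sup>2 * b\<^sup>2 + \<delta>\<^sup>2 + (\<Sum>j<J. (r (Suc j))\<^sup>2 * indicator (E j) \<omega>))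
        = expectation (\<lambda>\<omega>. 4 * C\<^sup>2 * b\<^sup>2 + \<delta>\<^sup>2)
          + expectation (\<lambda>\<omega>. \<Sum>j<J. (r (Suc j))\<^sup>2 * indicator (E j) \<omega>)"
      by (intro Bochner_Integration.integral_add Bochner_Integration.integrable_sum int_E) auto
    also have "expectation (\<lambda>\<omega>. \<Sum>j<J. (r (Suc j))\<^sup>2 * indicator (E j) \<omega>)
        = (\<Sum>j<J. expectation (\<lambda>\<omega>. (r (Suc j))\<^sup>2 * indicator (E j) \<omega>))"
      by (intro Bochner_Integration.integral_sum int_E)
    also have "\<dots> = (\<Sum>j<J. (r (Suc j))\<^sup>2 * prob (E j))"
      by (intro sum.cong refl) (simp add: sets.Int_space_eq1 E)
    finally show ?thesis
      by (simp add: prob_space)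
  qed
  also have "(\<Sum>j<J. (r (Suc j))\<^sup>2 * prob (E j)) \<le> (\<Sum>j<J. 2 * \<delta>\<^sup>2 * (1 / 4) ^ j)"
    by (intro sum_mono level)
  also have "(\<Sum>j<J. 2 * \<delta>\<^sup>2 * (1 / 4) ^ j) = 2 * \<delta>\<^sup>2 * (\<Sum>j<J. (1 / 4) ^ j)"
    by (simp only: sum_distrib_left)
  also have "(\<Sum>j<J. (1 / 4 :: real) ^ j) \<le> 3 / 2"
  proof -
    have "(\<Sum>j<J. (1 / 4 :: real) ^ j) = 4 / 3 * (1 - (1 / 4) ^ J)"
      by (simp add: sum_gp_strict)
    also have "\<dots> \<le> 4 / 3 * 1"
      by (intro mult_left_mono) auto
    finally show ?thesis by simp
  qed
  finally have "expectation (\<lambda>\<omega>. (x \<omega>)\<^sup>2) \<le> 4 * C\<^sup>2 * b\<^sup>2 + \<delta>\<^sup>2 + 2 * \<delta>\<^sup>2 * (3 / 2)"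
    by (simp add: mult_left_mono)
  then show ?thesis
    by (simp add: x_def \<delta>_def)
qed

section \<open>The bias of the local polynomial criterion\<close>

lemma (in prob_space) expectation_le_of_nn_second_moment:
  fixes L :: "'a \<Rightarrow> real"
  assumes [measurable]: "L \<in> borel_measurable M" and C: "0 < C"
    and L2: "(\<integral>\<^sup>+y. ennreal ((L y)\<^sup>2) \<partial>M) \<le> ennreal (C\<^sup>2)"
  shows "integrable M L" "expectation L \<le> C"
proof -
  have int2: "integrable M (\<lambda>y. (L y)\<^sup>2)"
    using L2 by (intro integrableI_nonneg) (auto simp: less_top[symmetric] top_unique)
  then show int: "integrable M L"
    by (rule square_integrable_imp_integrable[rotated]) simp
  have "ennreal (expectation (\<lambda>y. (L y)\<^sup>2)) \<le> ennreal (C\<^sup>2)"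
    using L2 by (subst nn_integral_eq_integral[symmetric]) (auto intro: int2)
  then have "expectation (\<lambda>y. (L y)\<^sup>2) \<le> C\<^sup>2"
    by (subst (asm) ennreal_le_iff) auto
  \<comment> \<open>\<open>2 L C \<le> L\<^sup>2 + C\<^sup>2\<close> replaces Cauchy-Schwarz\<close>
  have "L y \<le> (L y)\<^sup>2 / (2 * C) + C / 2" for y
  proof -
    have "0 \<le> (L y - C)\<^sup>2 / (2 * C)"
      using C by simp
    also have "(L y - C)\<^sup>2 / (2 * C) = (L y)\<^sup>2 / (2 * C) + C / 2 - L y"
      using C by (simp add: power2_eq_square field_simps)
    finally show ?thesis by simp
  qed
  then have "expectation L \<le> expectation (\<lambda>y. (L y)\<^sup>2 / (2 * C) + C / 2)"
    using int int2 by (intro integral_mono) auto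
  also have "\<dots> = expectation (\<lambda>y. (L y)\<^sup>2) / (2 * C) + C / 2"
    using int2 by (simp add: prob_space)
  also have "\<dots> \<le> C\<^sup>2 / (2 * C) + C / 2"
    using \<open>expectation (\<lambda>y. (L y)\<^sup>2) \<le> C\<^sup>2\<close> C by (intro add_right_mono divide_right_mono) auto
  also have "\<dots> = C"
    using C by (simp add: power2_eq_square)
  finally show "expectation L \<le> C" .
qed

lemma design_point_in: "i \<in> {1..n} \<Longrightarrow> design_point n i \<in> {0..1}"
  by (auto simp: design_point_def divide_simps)

lemma (in prob_space) expectation_sample_eq:
  assumes Q: "Metric_space Q d" and q: "q \<in> Q" and i: "i \<in> {1..n}"
    and model: "frechet_regression M Q d Y m" and sample: "regression_sample M Q d Y n y"
  shows "expectation (\<lambda>\<omega>. (d (y i \<omega>) q)\<^sup>2) = expectation (\<lambda>\<omega>. (d (Y (design_point n i) \<omega>) q)\<^sup>2)"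
proof -
  let ?N = "metric_borel Q d"
  note [measurable] = borel_measurable_dist[OF Q q]
  have [measurable]: "Y (design_point n i) \<in> measurable M ?N"
    using model design_point_in[OF i] unfolding frechet_regression_def by blast
  have [measurable]: "y i \<in> measurable M ?N"
    using sample i unfolding regression_sample_def indep_vars_def by auto
  have "expectation (\<lambda>\<omega>. (d (y i \<omega>) q)\<^sup>2) = (\<integral>x. (d x q)\<^sup>2 \<partial>distr M ?N (y i))"
    by (subst integral_distr) auto
  also have "distr M ?N (y i) = distr M ?N (Y (design_point n i))"
    using sample i unfolding regression_sample_def by blast
  also have "(\<integral>x. (d x q)\<^sup>2 \<partial>distr M ?N (Y (design_point n i)))
      = expectation (\<lambda>\<omega>. (d (Y (design_point n i) \<omega>) q)\<^sup>2)"
    by (subst integral_distr) auto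
  finally show ?thesis .
qed

text \<open>All the expectations are integrals of \<open>d(z,q)\<^sup>2 - d(z,p)\<^sup>2\<close> against densities with respect to \<open>\<mu>\<close>, so the
bias is the integral of this difference times the pointwise bias \<open>\<rho>(z|t) - \<Sum>i. w\<^sub>i \<rho>(z|x\<^sub>i)\<close> of the weights. The
first factor is at most \<open>2 D d(q,p)\<close>, which makes the bias linear in the distance.\<close>

lemma (in prob_space) lp_criterion_bias:
  assumes Q: "Metric_space Q d" and D: "\<And>p q. p \<in> Q \<Longrightarrow> q \<in> Q \<Longrightarrow> d p q \<le> D"
    and \<beta>: "0 < \<beta>" and l: "l = strict_floor \<beta>" and h: "0 < h"
    and model: "frechet_regression M Q d Y m" and sample: "regression_sample M Q d Y n y"
    and smooth: "hoelder_smooth_density M Q d Y m \<mu> \<rho> \<beta> CLen CInt CSmD"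
    and K: "kernel_cond K CKmi CKma" and t: "t \<in> {0..1}"
    and inv: "invertible_mat (lp_matrix K l n h t)"
    and p: "p \<in> Q" and q: "q \<in> Q"
  shows "\<bar>expectation (\<lambda>\<omega>. (d (Y t \<omega>) q)\<^sup>2 - (d (Y t \<omega>) p)\<^sup>2)
      - (\<Sum>i=1..n. lp_weight K l n h t i *
          (expectation (\<lambda>\<omega>. (d (y i \<omega>) q)\<^sup>2) - expectation (\<lambda>\<omega>. (d (y i \<omega>) p)\<^sup>2)))\<bar>
    \<le> 2 * D * CSmD * (h powr \<beta> * (\<Sum>i=1..n. \<bar>lp_weight K l n h t i\<bar>) / fact (l - 1)) * d q p"
proof -
  interpret Q: Metric_space Q d by fact
  define A where "A = h powr \<beta> * (\<Sum>i=1..n. \<bar>lp_weight K l n h t i\<bar>) / fact (l - 1)"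
  define w where "w i = lp_weight K l n h t i" for i
  define x where "x i = design_point n i" for i
  define G where "G z = (d z q)\<^sup>2 - (d z p)\<^sup>2" for z
  have x01: "x i \<in> {0..1}" if "i \<in> {1..n}" for i
    unfolding x_def using that by (rule design_point_in)
  from smooth have CSmD: "1 \<le> CSmD" and \<mu>: "prob_space \<mu>" and sets_\<mu>: "sets \<mu> = sets (metric_borel Q d)"
    and \<rho>_nonneg: "\<And>z s. z \<in> Q \<Longrightarrow> s \<in> {0..1} \<Longrightarrow> 0 \<le> \<rho> z s"
    and dens: "\<And>s. s \<in> {0..1} \<Longrightarrow> distributed M \<mu> (Y s) (\<lambda>z. ennreal (\<rho> z s))"
    unfolding hoelder_smooth_density_def by auto
  from smooth obtain L where L_meas: "L \<in> borel_measurable \<mu>"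
    and L: "AE z in \<mu>. 0 \<le> L z \<and> \<rho> z \<in> hoelder_class \<beta> (L z)"
    and L2: "(\<integral>\<^sup>+z. ennreal ((L z)\<^sup>2) \<partial>\<mu>) \<le> ennreal (CSmD\<^sup>2)"
    unfolding hoelder_smooth_density_def by auto
  interpret \<mu>: prob_space \<mu> by fact
  have space_\<mu>: "space \<mu> = Q"
    using sets_eq_imp_space_eq[OF sets_\<mu>] space_metric_borel[OF Q] by simp
  have L_int: "integrable \<mu> L" and L_le: "\<mu>.expectation L \<le> CSmD"
    using \<mu>.expectation_le_of_nn_second_moment[OF L_meas _ L2] CSmD by auto
  have dist_meas: "(\<lambda>z. d z r) \<in> borel_measurable \<mu>" if "r \<in> Q" for r
    using borel_measurable_dist[OF Q that] measurable_cong_sets[OF sets_\<mu> refl] by blast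
  have G_meas: "G \<in> borel_measurable \<mu>"
    unfolding G_def using dist_meas[OF p] dist_meas[OF q] by measurable
  have G_bound: "\<bar>G z\<bar> \<le> 2 * D * d q p" if "z \<in> Q" for z
    unfolding G_def using that p q D by (intro abs_diff_squared_dist_le[OF Q])
  have D0: "0 \<le> D"
    by (rule order_trans[OF Q.nonneg D[OF p p]])
  have Y_int: "integrable M (\<lambda>\<omega>. (d (Y s \<omega>) r)\<^sup>2)" if "s \<in> {0..1}" "r \<in> Q" for s r
    using model that unfolding frechet_regression_def by blast
  have G_int: "integrable M (\<lambda>\<omega>. G (Y s \<omega>))" if "s \<in> {0..1}" for s
    unfolding G_def by (intro Bochner_Integration.integrable_diff Y_int that p q)
  have \<rho>G_int: "integrable \<mu> (\<lambda>z. \<rho> z s * G z)" if "s \<in> {0..1}" for s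
    using distributed_integrable[OF dens[OF that] G_meas] \<rho>_nonneg[OF _ that] G_int[OF that]
    by (simp add: space_\<mu>)
  have \<rho>G: "(\<integral>z. \<rho> z s * G z \<partial>\<mu>) = expectation (\<lambda>\<omega>. G (Y s \<omega>))" if "s \<in> {0..1}" for s
    using distributed_integral[OF dens[OF that] G_meas] \<rho>_nonneg[OF _ that]
    by (simp add: space_\<mu>)
  have sample_mean: "expectation (\<lambda>\<omega>. (d (y i \<omega>) q)\<^sup>2) - expectation (\<lambda>\<omega>. (d (y i \<omega>) p)\<^sup>2)
      = expectation (\<lambda>\<omega>. G (Y (x i) \<omega>))" if i: "i \<in> {1..n}" for i
    unfolding expectation_sample_eq[OF Q p i model sample] expectation_sample_eq[OF Q q i model sample]
      x_def[symmetric] G_def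
    by (rule Bochner_Integration.integral_diff[symmetric]) (intro Y_int x01 i p q)+
  have "expectation (\<lambda>\<omega>. (d (Y t \<omega>) q)\<^sup>2 - (d (Y t \<omega>) p)\<^sup>2)
      - (\<Sum>i=1..n. w i * (expectation (\<lambda>\<omega>. (d (y i \<omega>) q)\<^sup>2) - expectation (\<lambda>\<omega>. (d (y i \<omega>) p)\<^sup>2)))
      = (\<integral>z. \<rho> z t * G z \<partial>\<mu>) - (\<Sum>i=1..n. w i * (\<integral>z. \<rho> z (x i) * G z \<partial>\<mu>))"
  proof -
    have "w i * (expectation (\<lambda>\<omega>. (d (y i \<omega>) q)\<^sup>2) - expectation (\<lambda>\<omega>. (d (y i \<omega>) p)\<^sup>2))
        = w i * (\<integral>z. \<rho> z (x i) * G z \<partial>\<mu>)" if "i \<in> {1..n}" for i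
      unfolding sample_mean[OF that] \<rho>G[OF x01[OF that]] ..
    then have "(\<Sum>i=1..n. w i * (expectation (\<lambda>\<omega>. (d (y i \<omega>) q)\<^sup>2) - expectation (\<lambda>\<omega>. (d (y i \<omega>) p)\<^sup>2)))
        = (\<Sum>i=1..n. w i * (\<integral>z. \<rho> z (x i) * G z \<partial>\<mu>))"
      by (rule sum.cong[OF refl])
    then show ?thesis
      unfolding \<rho>G[OF t] G_def[symmetric] by (rule arg_cong)
  qed
  also have "\<dots> = (\<integral>z. \<rho> z t * G z - (\<Sum>i=1..n. w i * (\<rho> z (x i) * G z)) \<partial>\<mu>)"
    using \<rho>G_int[OF t] \<rho>G_int[OF x01]
    by (subst Bochner_Integration.integral_diff) (auto simp: Bochner_Integration.integral_sum)
  finally have eq: "expectation (\<lambda>\<omega>. (d (Y t \<omega>) q)\<^sup>2 - (d (Y t \<omega>) p)\<^sup>2)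
      - (\<Sum>i=1..n. w i * (expectation (\<lambda>\<omega>. (d (y i \<omega>) q)\<^sup>2) - expectation (\<lambda>\<omega>. (d (y i \<omega>) p)\<^sup>2)))
      = (\<integral>z. \<rho> z t * G z - (\<Sum>i=1..n. w i * (\<rho> z (x i) * G z)) \<partial>\<mu>)" .
  have "\<bar>\<integral>z. \<rho> z t * G z - (\<Sum>i=1..n. w i * (\<rho> z (x i) * G z)) \<partial>\<mu>\<bar>
      \<le> (\<integral>z. \<bar>\<rho> z t * G z - (\<Sum>i=1..n. w i * (\<rho> z (x i) * G z))\<bar> \<partial>\<mu>)"
    by (rule integral_abs_bound)
  also have "\<dots> \<le> (\<integral>z. 2 * D * A * d q p * L z \<partial>\<mu>)"
  proof (rule integral_mono_AE)
    show "integrable \<mu> (\<lambda>z. \<bar>\<rho> z t * G z - (\<Sum>i=1..n. w i * (\<rho> z (x i) * G z))\<bar>)"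
      by (intro integrable_abs Bochner_Integration.integrable_diff Bochner_Integration.integrable_sum
          integrable_mult_right \<rho>G_int t x01)
    show "integrable \<mu> (\<lambda>z. 2 * D * A * d q p * L z)"
      using L_int by simp
    show "AE z in \<mu>. \<bar>\<rho> z t * G z - (\<Sum>i=1..n. w i * (\<rho> z (x i) * G z))\<bar> \<le> 2 * D * A * d q p * L z"
      using L AE_space
    proof eventually_elim
      case (elim z)
      have "\<bar>\<rho> z t * G z - (\<Sum>i=1..n. w i * (\<rho> z (x i) * G z))\<bar>
          = \<bar>(\<Sum>i=1..n. w i * \<rho> z (x i)) - \<rho> z t\<bar> * \<bar>G z\<bar>"
        unfolding abs_mult[symmetric] left_diff_distrib sum_distrib_right
        by (simp add: abs_minus_commute mult.assoc)
      also have "\<dots> \<le> (L z * A) * (2 * D * d q p)"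
        using elim unfolding A_def w_def x_def
        by (intro mult_mono lp_weight_hoelder_bias[OF inv K t h \<beta> l] G_bound)
           (auto simp: space_\<mu> intro!: mult_nonneg_nonneg divide_nonneg_nonneg sum_nonneg)
      finally show ?case
        by (simp add: mult_ac)
    qed
  qed
  also have "\<dots> = 2 * D * A * d q p * \<mu>.expectation L"
    by simp
  also have "\<dots> \<le> 2 * D * A * d q p * CSmD"
    using D0 by (intro mult_left_mono L_le mult_nonneg_nonneg) (auto simp: A_def sum_nonneg)
  finally show ?thesis
    unfolding eq[unfolded w_def] A_def[symmetric] by (simp add: w_def mult_ac)
qed

section \<open>The risk bound\<close>

lemma dist_le_diam:
  assumes "ediam d Q < \<infinity>" "p \<in> Q" "q \<in> Q"
  shows "d p q \<le> diam d Q"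
proof -
  have "ennreal (d p q) \<le> ennreal (diam d Q)"
    using dist_le_ediam[OF assms(2,3), of d] assms(1) by (simp add: diam_def)
  then show ?thesis
    by (subst (asm) ennreal_le_iff) (simp_all add: diam_def)
qed

text \<open>The reason why the bias constant does not depend on the order \<open>l\<close>: an exponential against a factorial. The
case \<open>l = 0\<close> falls under the convention \<open>0 - 1 = 0\<close>.\<close>

lemma point_eval_const_le_fact:
  "point_eval_const l / (fact (l - 1))\<^sup>2 \<le> 128 * exp 8"
proof (cases l)
  case 0
  have "(1::real) \<le> exp 8" by simp
  then have "(16::real) \<le> 128 * exp 8" by linarith
  then show ?thesis
    using 0 by (simp only: point_eval_const_def) simp
next
  case (Suc m)
  have m: "real m + 2 \<le> 2 * 2 ^ m"
  proof -
    have "real (Suc m) \<le> 2 ^ m"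
      using of_nat_mono[OF Suc_leI[OF less_exp[of m]], where ?'a = real] by simp
    then show ?thesis by simp
  qed
  have "8 ^ m / fact m = (8::real) ^ m /\<^sub>R fact m"
    by (simp add: divide_inverse mult.commute)
  also have "\<dots> \<le> (\<Sum>k. 8 ^ k /\<^sub>R fact k)"
    using sum_le_suminf[OF summable_exp_generic, of "{m}" "8::real"] by simp
  also have "\<dots> = exp 8"
    by (simp add: exp_def)
  finally have exp8: "8 ^ m / fact m \<le> exp (8::real)" .
  have "point_eval_const l / (fact (l - 1))\<^sup>2 = 64 * ((real m + 2) * 4 ^ m / (fact m)\<^sup>2)"
    by (simp add: Suc point_eval_const_def add.commute)
  also have "\<dots> \<le> 64 * (2 * 2 ^ m * 4 ^ m / (fact m)\<^sup>2)"
    by (intro mult_left_mono divide_right_mono mult_right_mono m) auto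
  also have "\<dots> = 128 * (8 ^ m / fact m * (1 / fact m))"
    by (simp add: power2_eq_square flip: power_mult_distrib)
  also have "\<dots> \<le> 128 * (exp 8 * 1)"
    by (intro mult_left_mono mult_mono exp8) (auto simp: fact_ge_1)
  finally show ?thesis by simp
qed

text \<open>The regime in which the window contains enough design points. The basic inequality combines the
variance inequality, the bias bound and minimality of the estimator; peeling then does the rest, with
\<open>V\<close> an upper bound on the sum of the squared weights.\<close>

lemma (in prob_space) lp_frechet_risk:
  assumes Q: "Metric_space Q d" and bounded: "ediam d Q < \<infinity>"
    and \<beta>: "0 < \<beta>" and l: "l = strict_floor \<beta>"
    and model: "frechet_regression M Q d Y m" and sample: "regression_sample M Q d Y n y"
    and h: "0 < h" "h \<le> 1" and N: "2 * real (Suc l) \<le> real n * h"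
    and vi: "var_ineq M Q d Y m CVlo" and ent: "entropy_cond Q d CEnt"
    and smooth: "hoelder_smooth_density M Q d Y m \<mu> \<rho> \<beta> CLen CInt CSmD"
    and K: "kernel_cond K CKmi CKma" and CKer: "CKer = CKmi * CKma"
    and t: "t \<in> {0..1}" and est: "lp_frechet_estimator M Q d y K l n h t mhat"
    and diam: "0 < diam d Q"
  shows "expectation (\<lambda>\<omega>. (d (mhat \<omega>) (m t))\<^sup>2)
    \<le> 48 * (128 * exp 8) * CVlo\<^sup>2 * CKer\<^sup>2 * CSmD\<^sup>2 * (diam d Q)\<^sup>2 * h powr (2 * \<beta>)
      + 36864 * point_eval_const l * CVlo\<^sup>2 * CEnt\<^sup>2 * CKer\<^sup>2 * (diam d Q)\<^sup>2 * inverse (real n * h)"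
proof -
  interpret Q: Metric_space Q d by fact
  define D where "D = diam d Q"
  define w where "w i = lp_weight K l n h t i" for i
  define V where "V = CKer\<^sup>2 * point_eval_const l / (real n * h)"
  define A where "A = h powr \<beta> * (\<Sum>i=1..n. \<bar>w i\<bar>) / fact (l - 1)"
  define b where "b = 2 * D * CSmD * A"
  define X where "X = weighted_dev d y w n"
  have D0: "0 < D" and D: "\<And>p q. p \<in> Q \<Longrightarrow> q \<in> Q \<Longrightarrow> d p q \<le> D"
    using diam dist_le_diam[OF bounded] by (auto simp: D_def)
  have CV: "1 \<le> CVlo"
    and vi': "\<And>q. q \<in> Q \<Longrightarrow> inverse CVlo * (d q (m t))\<^sup>2
          \<le> expectation (\<lambda>\<omega>. (d (Y t \<omega>) q)\<^sup>2 - (d (Y t \<omega>) (m t))\<^sup>2)"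
    using vi t unfolding var_ineq_def by auto
  have CS: "1 \<le> CSmD"
    using smooth unfolding hoelder_smooth_density_def by auto
  have CK: "1 \<le> CKer"
    using kernel_condD(1,2)[OF K] mult_mono[of 1 CKmi 1 CKma] by (simp add: CKer)
  have N0: "0 < real n * h"
    using N by (simp add: order.strict_trans2[rotated])
  have pc0: "0 < point_eval_const l"
    by (simp add: point_eval_const_def)
  have mt: "m t \<in> Q"
    using model t unfolding frechet_regression_def is_arg_min_def by blast
  have inv: "invertible_mat (lp_matrix K l n h t)"
    and mhat: "mhat \<in> measurable M (metric_borel Q d)"
    and argmin: "\<And>\<omega>. \<omega> \<in> space M \<Longrightarrow>
          is_arg_min (\<lambda>q. \<Sum>i=1..n. w i * (d (y i \<omega>) q)\<^sup>2) (\<lambda>q. q \<in> Q) (mhat \<omega>)"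
    using est unfolding lp_frechet_estimator_def w_def by auto
  have indep: "indep_vars (\<lambda>_. metric_borel Q d) y {1..n}"
    using sample unfolding regression_sample_def by blast
  have CKer_le: "CKer \<le> CKer\<^sup>2"
    using CK by (simp add: power2_eq_square)
  have w2: "(\<Sum>i=1..n. (w i)\<^sup>2) \<le> V"
  proof -
    have "(\<Sum>i=1..n. (w i)\<^sup>2) \<le> CKer * point_eval_const l / (real n * h)"
      using lp_weight_bounds(1)[OF inv K t h N] by (simp add: w_def CKer)
    also have "\<dots> \<le> V"
      unfolding V_def using CKer_le pc0 N0 by (intro divide_right_mono mult_right_mono) auto
    finally show ?thesis .
  qed
  have V0: "0 < V"
    using CK pc0 N0 by (simp add: V_def)
  have A0: "0 \<le> A"
    by (simp add: A_def sum_nonneg)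
  have basic: "(d (mhat \<omega>) (m t))\<^sup>2
      \<le> CVlo * (b * d (mhat \<omega>) (m t) + \<bar>X (mhat \<omega>) \<omega> - X (m t) \<omega>\<bar>)"
    if \<omega>: "\<omega> \<in> space M" for \<omega>
  proof -
    define q where "q = mhat \<omega>"
    have q: "q \<in> Q"
      using measurable_space[OF mhat \<omega>] by (simp add: q_def space_metric_borel[OF Q])
    define e where "e i r = expectation (\<lambda>\<omega>. (d (y i \<omega>) r)\<^sup>2)" for i r
    define T where "T = (\<Sum>i=1..n. w i * (e i q - e i (m t)))"
    have "(\<Sum>i=1..n. w i * (d (y i \<omega>) q)\<^sup>2) \<le> (\<Sum>i=1..n. w i * (d (y i \<omega>) (m t))\<^sup>2)"
      using argmin[OF \<omega>] mt unfolding is_arg_min_def q_def by (auto simp: not_less)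
    moreover have "X q \<omega> - X (m t) \<omega>
        = (\<Sum>i=1..n. w i * (d (y i \<omega>) q)\<^sup>2) - (\<Sum>i=1..n. w i * (d (y i \<omega>) (m t))\<^sup>2) - T"
      unfolding X_def weighted_dev_def T_def e_def sum_subtractf[symmetric]
      by (intro sum.cong) (auto simp: algebra_simps)
    ultimately have T_le: "T \<le> \<bar>X q \<omega> - X (m t) \<omega>\<bar>"
      by linarith
    have "\<bar>expectation (\<lambda>\<omega>. (d (Y t \<omega>) q)\<^sup>2 - (d (Y t \<omega>) (m t))\<^sup>2) - T\<bar> \<le> b * d q (m t)"
      using lp_criterion_bias[OF Q D \<beta> l h(1) model sample smooth K t inv mt q]
      unfolding T_def e_def w_def[symmetric] A_def[symmetric] b_def .
    then have "inverse CVlo * (d q (m t))\<^sup>2 \<le> b * d q (m t) + \<bar>X q \<omega> - X (m t) \<omega>\<bar>"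
      using vi'[OF q] T_le by linarith
    then have "CVlo * (inverse CVlo * (d q (m t))\<^sup>2) \<le> CVlo * (b * d q (m t) + \<bar>X q \<omega> - X (m t) \<omega>\<bar>)"
      using CV by (intro mult_left_mono) auto
    also have "CVlo * (inverse CVlo * (d q (m t))\<^sup>2) = (d q (m t))\<^sup>2"
      using CV by simp
    finally show ?thesis
      unfolding q_def .
  qed
  have main: "expectation (\<lambda>\<omega>. (d (mhat \<omega>) (m t))\<^sup>2)
      \<le> 4 * CVlo\<^sup>2 * b\<^sup>2 + 4 * (48 * CVlo * (2 * sqrt V * D) * CEnt)\<^sup>2"
  proof (rule peeling_second_moment[where X = X and \<Lambda> = "4 * D * (\<Sum>i=1..n. \<bar>w i\<bar>)",
        OF Q mt _ ent mhat])
    show "X p \<in> borel_measurable M" if "p \<in> Q" for p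
      unfolding X_def by (rule weighted_dev_measurable[OF Q indep that])
    show "prob {\<omega>\<in>space M. v * (2 * sqrt V * D) * d p q < \<bar>X p \<omega> - X q \<omega>\<bar>} \<le> 2 * exp (- (v\<^sup>2 / 2))"
      if "p \<in> Q" "q \<in> Q" "0 \<le> v" for p q v
      unfolding X_def by (rule weighted_dev_increment[OF Q indep D w2 that])
    show "\<bar>X p \<omega> - X q \<omega>\<bar> \<le> 4 * D * (\<Sum>i=1..n. \<bar>w i\<bar>) * d p q"
      if "p \<in> Q" "q \<in> Q" "\<omega> \<in> space M" for p q \<omega>
      unfolding X_def by (rule weighted_dev_lipschitz[OF Q indep D that])
    show "0 < 2 * sqrt V * D" "1 \<le> CVlo" "0 \<le> b"
      using V0 D0 CV CS A0 by (simp_all add: b_def)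
  qed (fact D basic)+
  have A2: "A\<^sup>2 \<le> 3 * (128 * exp 8) * CKer\<^sup>2 * h powr (2 * \<beta>)"
  proof -
    have "A\<^sup>2 = (h powr \<beta>)\<^sup>2 * (\<Sum>i=1..n. \<bar>w i\<bar>)\<^sup>2 / (fact (l - 1))\<^sup>2"
      by (simp add: A_def power_mult_distrib power_divide)
    also have "\<dots> \<le> (h powr \<beta>)\<^sup>2 * (3 * (CKer * point_eval_const l)) / (fact (l - 1))\<^sup>2"
      using lp_weight_bounds(2)[OF inv K t h N]
      by (intro divide_right_mono mult_left_mono) (auto simp: w_def CKer)
    also have "\<dots> = 3 * (CKer * (h powr \<beta>)\<^sup>2) * (point_eval_const l / (fact (l - 1))\<^sup>2)"
      by simp
    also have "\<dots> \<le> 3 * (CKer\<^sup>2 * (h powr \<beta>)\<^sup>2) * (128 * exp 8)"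
      using CK CKer_le pc0 by (intro mult_mono point_eval_const_le_fact) auto
    also have "(h powr \<beta>)\<^sup>2 = h powr (2 * \<beta>)"
      by (simp add: power2_eq_square flip: powr_add)
    finally show ?thesis
      by (simp add: mult_ac)
  qed
  have "4 * CVlo\<^sup>2 * b\<^sup>2 = 16 * CVlo\<^sup>2 * CSmD\<^sup>2 * D\<^sup>2 * A\<^sup>2"
    by (simp add: b_def power_mult_distrib)
  also have "\<dots> \<le> 16 * CVlo\<^sup>2 * CSmD\<^sup>2 * D\<^sup>2 * (3 * (128 * exp 8) * CKer\<^sup>2 * h powr (2 * \<beta>))"
    by (intro mult_left_mono A2) auto
  finally have bias: "4 * CVlo\<^sup>2 * b\<^sup>2
      \<le> 48 * (128 * exp 8) * CVlo\<^sup>2 * CKer\<^sup>2 * CSmD\<^sup>2 * D\<^sup>2 * h powr (2 * \<beta>)"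
    by (simp add: mult_ac)
  have "4 * (48 * CVlo * (2 * sqrt V * D) * CEnt)\<^sup>2 = 36864 * CVlo\<^sup>2 * V * D\<^sup>2 * CEnt\<^sup>2"
    using V0 by (simp add: power_mult_distrib)
  also have "\<dots> = 36864 * point_eval_const l * CVlo\<^sup>2 * CEnt\<^sup>2 * CKer\<^sup>2 * D\<^sup>2 * inverse (real n * h)"
    by (simp add: V_def divide_inverse mult_ac)
  finally have "4 * (48 * CVlo * (2 * sqrt V * D) * CEnt)\<^sup>2
      = 36864 * point_eval_const l * CVlo\<^sup>2 * CEnt\<^sup>2 * CKer\<^sup>2 * D\<^sup>2 * inverse (real n * h)" .
  then show ?thesis
    using main bias unfolding D_def by linarith
qed

theorem theorem1:
  shows "\<exists>c0 c0' c1 :: real. \<exists>c2 :: nat \<Rightarrow> real.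
    0 < c0 \<and> 0 < c0' \<and> 0 < c1 \<and> (\<forall>l. 0 < c2 l) \<and>
    (\<forall>(P :: 'w measure) (Q :: 'a set) d Y m \<beta> l n y K h \<mu> \<rho>
        CVlo CEnt CLen CInt CSmD CKmi CKma CKer C1 C2.
       prob_space P \<longrightarrow>
       Metric_space Q d \<longrightarrow> ediam d Q < \<infinity> \<longrightarrow>
       0 < \<beta> \<longrightarrow> l = strict_floor \<beta> \<longrightarrow>
       frechet_regression P Q d Y m \<longrightarrow>
       regression_sample P Q d Y n y \<longrightarrow>
       c0 / real n \<le> h \<longrightarrow> c0' \<le> real n \<longrightarrow>
       var_ineq P Q d Y m CVlo \<longrightarrow>
       entropy_cond Q d CEnt \<longrightarrow>
       hoelder_smooth_density P Q d Y m \<mu> \<rho> \<beta> CLen CInt CSmD \<longrightarrow>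
       kernel_cond K CKmi CKma \<longrightarrow>
       CKer = CKmi * CKma \<longrightarrow>
       C1 = c1 * CVlo\<^sup>2 * CKer\<^sup>2 * CSmD\<^sup>2 * (diam d Q)\<^sup>2 \<longrightarrow>
       C2 = c2 l * CVlo\<^sup>2 * CEnt\<^sup>2 * CKer\<^sup>2 * (diam d Q)\<^sup>2 \<longrightarrow>
       (\<forall>t\<in>{0..1}. \<forall>mhat. lp_frechet_estimator P Q d y K l n h t mhat \<longrightarrow>
          (\<integral>\<omega>. (d (m t) (mhat \<omega>))\<^sup>2 \<partial>P) \<le> C1 * h powr (2 * \<beta>) + C2 * inverse (real n * h)))"
proof (rule exI[of _ 1], rule exI[of _ 1], rule exI[of _ "48 * (128 * exp 8)"],
    rule exI[of _ "\<lambda>l. 36864 * point_eval_const l"], intro conjI allI impI ballI)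
  show "0 < (1::real)" "0 < (1::real)" "0 < 48 * (128 * exp (8::real))" by simp_all
  show "0 < 36864 * point_eval_const l" for l
    by (simp add: point_eval_const_def)
next
  fix P :: "'w measure" and Q :: "'a set" and d Y m \<beta> l n y K h \<mu> \<rho>
    CVlo CEnt CLen CInt CSmD CKmi CKma CKer C1 C2 t mhat
  assume P: "prob_space P" and Q: "Metric_space Q d" and bounded: "ediam d Q < \<infinity>"
    and \<beta>: "0 < \<beta>" and l: "l = strict_floor \<beta>"
    and model: "frechet_regression P Q d Y m" and sample: "regression_sample P Q d Y n y"
    and hn: "1 / real n \<le> h" and n: "1 \<le> real n"
    and vi: "var_ineq P Q d Y m CVlo" and ent: "entropy_cond Q d CEnt"
    and smooth: "hoelder_smooth_density P Q d Y m \<mu> \<rho> \<beta> CLen CInt CSmD"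
    and K: "kernel_cond K CKmi CKma" and CKer: "CKer = CKmi * CKma"
    and C1: "C1 = 48 * (128 * exp 8) * CVlo\<^sup>2 * CKer\<^sup>2 * CSmD\<^sup>2 * (diam d Q)\<^sup>2"
    and C2: "C2 = 36864 * point_eval_const l * CVlo\<^sup>2 * CEnt\<^sup>2 * CKer\<^sup>2 * (diam d Q)\<^sup>2"
    and t: "t \<in> {0..1}" and est: "lp_frechet_estimator P Q d y K l n h t mhat"
  interpret prob_space P by fact
  interpret Q: Metric_space Q d by fact
  define D where "D = diam d Q"
  have D: "d p q \<le> D" if "p \<in> Q" "q \<in> Q" for p q
    unfolding D_def using dist_le_diam[OF bounded that] .
  have h0: "0 < h"
    using hn n by (intro less_le_trans[OF _ hn]) auto
  have N0: "0 < real n * h"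
    using h0 n by simp
  have Ninv: "0 \<le> inverse (real n * h)"
    by (rule inverse_nonnegative_iff_nonnegative[THEN iffD2, OF less_imp_le[OF N0]])
  have C: "1 \<le> CVlo\<^sup>2" "1 \<le> CEnt\<^sup>2" "1 \<le> CSmD\<^sup>2"
    using vi ent smooth unfolding var_ineq_def entropy_cond_def hoelder_smooth_density_def
    by (auto simp: one_le_power)
  have CK: "1 \<le> CKer\<^sup>2"
    using kernel_condD(1,2)[OF K] mult_mono[of 1 CKmi 1 CKma] by (simp add: CKer one_le_power)
  have pc: "2 \<le> point_eval_const l" "2 * real (Suc l) \<le> point_eval_const l"
    using point_eval_const_ge[of l] by simp_all
  have mult_ge_1: "1 \<le> a * b" if "1 \<le> a" "1 \<le> b" for a b :: real
    using mult_mono[of 1 a 1 b] that by simp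
  have e8: "(1::real) \<le> exp 8" by simp
  have C1_ge: "D\<^sup>2 \<le> C1"
  proof -
    have "1 \<le> 48 * (128 * exp 8) * CVlo\<^sup>2 * CKer\<^sup>2 * CSmD\<^sup>2"
      using C CK e8 by (intro mult_ge_1) auto
    then have "1 * D\<^sup>2 \<le> 48 * (128 * exp 8) * CVlo\<^sup>2 * CKer\<^sup>2 * CSmD\<^sup>2 * D\<^sup>2"
      by (intro mult_right_mono) auto
    then show ?thesis by (simp add: C1 D_def)
  qed
  have C2_ge: "point_eval_const l * D\<^sup>2 \<le> C2"
  proof -
    have "1 \<le> 36864 * CVlo\<^sup>2 * CEnt\<^sup>2 * CKer\<^sup>2"
      using C CK by (intro mult_ge_1) auto
    then have "1 * (point_eval_const l * D\<^sup>2) \<le> 36864 * CVlo\<^sup>2 * CEnt\<^sup>2 * CKer\<^sup>2 * (point_eval_const l * D\<^sup>2)"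
      using pc by (intro mult_right_mono) auto
    then show ?thesis by (simp add: C2 D_def mult_ac)
  qed
  have C_nonneg: "0 \<le> C1" "0 \<le> C2"
    using C1_ge C2_ge pc by (auto intro: order_trans[rotated])
  have mhat: "mhat \<in> measurable P (metric_borel Q d)"
    using est unfolding lp_frechet_estimator_def by blast
  have mt: "m t \<in> Q"
    using model t unfolding frechet_regression_def is_arg_min_def by blast
  have crude: "expectation (\<lambda>\<omega>. (d (mhat \<omega>) (m t))\<^sup>2) \<le> D\<^sup>2"
  proof -
    have "(d (mhat \<omega>) (m t))\<^sup>2 \<le> D\<^sup>2" if "\<omega> \<in> space P" for \<omega>
      using measurable_space[OF mhat that] D mt by (intro power_mono) (auto simp: space_metric_borel[OF Q])
    then have "expectation (\<lambda>\<omega>. (d (mhat \<omega>) (m t))\<^sup>2) \<le> expectation (\<lambda>_. D\<^sup>2)"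
      by (intro integral_mono bounded_dist_integrable[OF Q mhat mt D]) auto
    then show ?thesis by (simp add: prob_space)
  qed
  have "expectation (\<lambda>\<omega>. (d (mhat \<omega>) (m t))\<^sup>2) \<le> C1 * h powr (2 * \<beta>) + C2 * inverse (real n * h)"
  proof -
    \<comment> \<open>in the first three cases the crude bound \<open>D\<^sup>2\<close> suffices\<close>
    consider "D = 0" | "1 < h" | "real n * h < 2 * real (Suc l)"
      | "D \<noteq> 0" "h \<le> 1" "2 * real (Suc l) \<le> real n * h"
      by linarith
    then show ?thesis
    proof cases
      case 1
      have "0 \<le> C1 * h powr (2 * \<beta>) + C2 * inverse (real n * h)"
        using C_nonneg Ninv by (intro add_nonneg_nonneg mult_nonneg_nonneg[OF _ Ninv] mult_nonneg_nonneg) auto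
      then show ?thesis
        using crude 1 by simp
    next
      case 2
      have "1 \<le> h powr (2 * \<beta>)"
        using 2 \<beta> by (intro ge_one_powr_ge_zero) auto
      then have "C1 * 1 \<le> C1 * h powr (2 * \<beta>)"
        using C_nonneg by (intro mult_left_mono) auto
      moreover have "0 \<le> C2 * inverse (real n * h)"
        using C_nonneg(2) Ninv by (rule mult_nonneg_nonneg)
      ultimately show ?thesis
        using crude C1_ge by linarith
    next
      case 3
      have "real n * h * D\<^sup>2 \<le> point_eval_const l * D\<^sup>2"
        using 3 pc by (intro mult_right_mono) auto
      also have "\<dots> \<le> C2" by (rule C2_ge)
      finally have "D\<^sup>2 \<le> C2 * inverse (real n * h)"
        using N0 by (simp add: divide_inverse[symmetric] le_divide_eq mult.commute)
      moreover have "0 \<le> C1 * h powr (2 * \<beta>)"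
        using C_nonneg by simp
      ultimately show ?thesis
        using crude by linarith
    next
      case 4
      have "0 < diam d Q"
        using 4 unfolding D_def diam_def by (simp add: order_less_le)
      then show ?thesis
        unfolding C1 C2
        by (intro lp_frechet_risk[OF Q bounded \<beta> l model sample h0 4(2,3) vi ent smooth K CKer t est])
    qed
  qed
  then show "(\<integral>\<omega>. (d (m t) (mhat \<omega>))\<^sup>2 \<partial>P) \<le> C1 * h powr (2 * \<beta>) + C2 * inverse (real n * h)"
    by (simp add: Q.commute)
qed

end
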